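(* Let $M'$ be an $m$-dimensional pseudo-Riemannian (non-degenerate) submanifold of an $n$-dimensional pseudo-Riemannian manifold $(M,g)$. If $(M,g,\eta,\nabla)$ and $(M,\widetilde g,\eta,\widetilde\nabla)$ are conformal-projective equivalent semi-Weyl manifolds admitting torsion (SWMT), then the induced structures $(g',\eta',\nabla')$ and $(\widetilde g',\eta',\widetilde\nabla')$ on $M'$ are conformal-projective equivalent, too.
   Context: For an affine connection $\nabla$ (possibly with torsion) on a pseudo-Riemannian manifold $(M,g)$ and a $1$-form $\eta$, put $T^\nabla(X,Y)=\nabla_XY-\nabla_YX-[X,Y]$. $(M,g,\eta,\nabla)$ is a SWMT if $(\nabla_Xg)(Y,Z)+\eta(X)g(Y,Z)=(\nabla_Yg)(X,Z)+\eta(Y)g(X,Z)-g(T^\nabla(X,Y),Z)$ for all vector fields $X,Y,Z$. Structures $(g,\eta,\nabla)$ and $(\widetilde g,\eta,\widetilde\nabla)$ on a manifold are conformal-projective equivalent if there are smooth functions $\phi,\psi$ on it with $\widetilde g=e^{\phi+\psi}g$ and $\widetilde\nabla_XY=\nabla_XY+d\phi(X)Y+d\phi(Y)X-g(X,Y)\,\mathrm{grad}_g\psi$ for all vector fields $X,Y$. A smooth submanifold $M'$ of $(M,g)$ is pseudo-Riemannian (non-degenerate) if $g'=g|_{TM'\times TM'}$ is a pseudo-Riemannian metric; then $T_xM=T_xM'\oplus T_x^\perp M'$ orthogonally. The structure $(g',\eta',\nabla')$ induced on $M'$ by $(g,\eta,\nabla)$ consists of the restrictions $g',\eta'$ of $g,\eta$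 to $TM'$ and of the connection $\nabla'$, where $\nabla'_XY$ is the component of $\nabla_XY$ tangent to $M'$ (with respect to the orthogonal decomposition) for $X,Y\in\Gamma^\infty(TM')$; similarly $(\widetilde g',\eta',\widetilde\nabla')$ is induced by $(\widetilde g,\eta,\widetilde\nabla)$. *)

theory Defs
  imports "HOL-Analysis.Analysis"
begin

text \<open>The class $C^k$ on an open set: the directional derivatives in all (fixed) directions are
  required to be of class $C^{k-1}$.\<close>

primrec Ck_on :: "nat \<Rightarrow> 'e::euclidean_space set \<Rightarrow> ('e \<Rightarrow> 'b::real_normed_vector) \<Rightarrow> bool" where
  "Ck_on 0 = (\<lambda>S f. continuous_on S f)"
| "Ck_on (Suc k) = (\<lambda>S f. (\<forall>x\<in>S. f differentiable (at x)) \<and>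
     (\<forall>v. Ck_on k S (\<lambda>x. frechet_derivative f (at x) v)))"

text \<open>On an arbitrary set, smooth means: locally the restriction of a $C^\infty$ function on an
  open set.  It is used for sets that are relatively open in a linear subspace, where it coincides
  with smoothness in linear coordinates of that subspace.\<close>

definition smooth_on :: "'e::euclidean_space set \<Rightarrow> ('e \<Rightarrow> 'b::real_normed_vector) \<Rightarrow> bool" where
  "smooth_on A f \<longleftrightarrow> (\<forall>x\<in>A. \<exists>U F. open U \<and> x \<in> U \<and> (\<forall>k. Ck_on k U F) \<and>
     (\<forall>y\<in>A \<inter> U. F y = f y))"

record ('a, 'e) manifold =
  mtop :: "'a topology"
  atlas :: "('a set \<times> ('a \<Rightarrow> 'e)) set"

abbreviation points :: "('a, 'e, 'z) manifold_scheme \<Rightarrow> 'a set" where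
  "points M \<equiv> topspace (mtop M)"

text \<open>The model space of an \<open>n\<close>-dimensional manifold is an \<open>n\<close>-dimensional linear subspace of the
  Euclidean space \<open>'e\<close>.  In this way the dimension is an ordinary natural number (the value 0
  included) and not a type.  The atlas need not be maximal.\<close>

definition smooth_manifold :: "nat \<Rightarrow> ('a, 'e::euclidean_space) manifold \<Rightarrow> bool" where
  "smooth_manifold n M \<longleftrightarrow>
     Hausdorff_space (mtop M) \<and> second_countable (mtop M) \<and>
     (\<exists>E::'e set. subspace E \<and> dim E = n \<and>
        (\<forall>(U, h)\<in>atlas M. openin (mtop M) U \<and> openin (top_of_set E) (h ` U) \<and>
           homeomorphic_map (subtopology (mtop M) U) (top_of_set (h ` U)) h)) \<and>
     (\<Union>(U, h)\<in>atlas M. U) = points M \<and>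
     (\<forall>(U, h)\<in>atlas M. \<forall>(V, k)\<in>atlas M. smooth_on (h ` (U \<inter> V)) (k \<circ> inv_into U h))"

text \<open>The values of a smooth function outside the carrier are irrelevant, so that restricting a
  function to a submanifold does not change it as a HOL function.\<close>

definition smooth_funs :: "('a, 'e::euclidean_space) manifold \<Rightarrow> ('a \<Rightarrow> real) set" where
  "smooth_funs M = {f. \<forall>(U, h)\<in>atlas M. smooth_on (h ` U) (f \<circ> inv_into U h)}"

definition smooth_map ::
  "('a, 'e::euclidean_space) manifold \<Rightarrow> ('b, 'f::euclidean_space) manifold \<Rightarrow> ('a \<Rightarrow> 'b) \<Rightarrow> bool" where
  "smooth_map M N F \<longleftrightarrow> continuous_map (mtop M) (mtop N) F \<and>
     (\<forall>(U, h)\<in>atlas M. \<forall>(V, k)\<in>atlas N.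
        smooth_on (h ` {p\<in>U. F p \<in> V}) (k \<circ> F \<circ> inv_into U h))"

type_synonym 'a tvec = "('a \<Rightarrow> real) \<Rightarrow> real"
type_synonym 'a vfield = "'a \<Rightarrow> 'a tvec"

text \<open>Tangent vectors at \<open>p\<close> are the derivations at \<open>p\<close> of the algebra of smooth functions; they are
  made extensional (0 on non-smooth functions) so that equality of HOL functions is equality of
  tangent vectors.  A derivation does not see the irrelevant values outside the carrier: if \<open>h\<close>
  vanishes on the carrier, then \<open>h = h * k\<close> for the indicator function \<open>k\<close> of the complement of
  the carrier, which is smooth and vanishes at \<open>p\<close>.\<close>

definition tangent_space :: "('a, 'e::euclidean_space) manifold \<Rightarrow> 'a \<Rightarrow> 'a tvec set" where
  "tangent_space M p = {v.
     (\<forall>f\<in>smooth_funs M. \<forall>h\<in>smooth_funs M. \<forall>a b. v (\<lambda>x. a * f x + b * h x) = a * v f + b * v h) \<and>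
     (\<forall>f\<in>smooth_funs M. \<forall>h\<in>smooth_funs M. v (\<lambda>x. f x * h x) = f p * v h + h p * v f) \<and>
     (\<forall>f. f \<notin> smooth_funs M \<longrightarrow> v f = 0)}"

text \<open>Vector fields are extensional, too: 0 outside the carrier.\<close>

definition vfields :: "('a, 'e::euclidean_space) manifold \<Rightarrow> 'a vfield set" where
  "vfields M = {X. (\<forall>p\<in>points M. X p \<in> tangent_space M p) \<and>
     (\<forall>p. p \<notin> points M \<longrightarrow> X p = (\<lambda>f. 0)) \<and>
     (\<forall>f\<in>smooth_funs M. (\<lambda>p. X p f) \<in> smooth_funs M)}"

definition lie_bracket :: "'a vfield \<Rightarrow> 'a vfield \<Rightarrow> 'a vfield" where
  "lie_bracket X Y = (\<lambda>p f. X p (\<lambda>q. Y q f) - Y p (\<lambda>q. X q f))"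

definition differential ::
  "('b, 'f::euclidean_space) manifold \<Rightarrow> ('a \<Rightarrow> 'b) \<Rightarrow> 'a tvec \<Rightarrow> 'b tvec" where
  "differential N F v = (\<lambda>f. if f \<in> smooth_funs N then v (f \<circ> F) else 0)"

type_synonym 'a metric = "'a \<Rightarrow> 'a tvec \<Rightarrow> 'a tvec \<Rightarrow> real"
type_synonym 'a form1 = "'a \<Rightarrow> 'a tvec \<Rightarrow> real"
type_synonym 'a connection = "'a vfield \<Rightarrow> 'a vfield \<Rightarrow> 'a vfield"

text \<open>On a connected manifold the index of such a metric is automatically constant; on a
  disconnected one it may depend on the component.\<close>

definition pseudo_riemannian_metric :: "('a, 'e::euclidean_space) manifold \<Rightarrow> 'a metric \<Rightarrow> bool" where
  "pseudo_riemannian_metric M g \<longleftrightarrow>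
     (\<forall>p\<in>points M. \<forall>u\<in>tangent_space M p. \<forall>v\<in>tangent_space M p. \<forall>w\<in>tangent_space M p. \<forall>a b.
        g p (\<lambda>f. a * u f + b * v f) w = a * g p u w + b * g p v w) \<and>
     (\<forall>p\<in>points M. \<forall>u\<in>tangent_space M p. \<forall>v\<in>tangent_space M p. g p u v = g p v u) \<and>
     (\<forall>p\<in>points M. \<forall>u\<in>tangent_space M p.
        (\<forall>v\<in>tangent_space M p. g p u v = 0) \<longrightarrow> u = (\<lambda>f. 0)) \<and>
     (\<forall>X\<in>vfields M. \<forall>Y\<in>vfields M. (\<lambda>p. g p (X p) (Y p)) \<in> smooth_funs M)"

definition one_form :: "('a, 'e::euclidean_space) manifold \<Rightarrow> 'a form1 \<Rightarrow> bool" where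
  "one_form M \<eta> \<longleftrightarrow>
     (\<forall>p\<in>points M. \<forall>u\<in>tangent_space M p. \<forall>v\<in>tangent_space M p. \<forall>a b.
        \<eta> p (\<lambda>f. a * u f + b * v f) = a * \<eta> p u + b * \<eta> p v) \<and>
     (\<forall>X\<in>vfields M. (\<lambda>p. \<eta> p (X p)) \<in> smooth_funs M)"

definition affine_connection :: "('a, 'e::euclidean_space) manifold \<Rightarrow> 'a connection \<Rightarrow> bool" where
  "affine_connection M D \<longleftrightarrow>
     (\<forall>X\<in>vfields M. \<forall>Y\<in>vfields M. D X Y \<in> vfields M) \<and>
     (\<forall>X\<in>vfields M. \<forall>Y\<in>vfields M. \<forall>Z\<in>vfields M.
        D (\<lambda>p f. X p f + Y p f) Z = (\<lambda>p f. D X Z p f + D Y Z p f)) \<and>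
     (\<forall>h\<in>smooth_funs M. \<forall>X\<in>vfields M. \<forall>Y\<in>vfields M.
        D (\<lambda>p f. h p * X p f) Y = (\<lambda>p f. h p * D X Y p f)) \<and>
     (\<forall>X\<in>vfields M. \<forall>Y\<in>vfields M. \<forall>Z\<in>vfields M.
        D X (\<lambda>p f. Y p f + Z p f) = (\<lambda>p f. D X Y p f + D X Z p f)) \<and>
     (\<forall>h\<in>smooth_funs M. \<forall>X\<in>vfields M. \<forall>Y\<in>vfields M.
        D X (\<lambda>p f. h p * Y p f) = (\<lambda>p f. X p h * Y p f + h p * D X Y p f))"

definition torsion :: "'a connection \<Rightarrow> 'a vfield \<Rightarrow> 'a vfield \<Rightarrow> 'a vfield" where
  "torsion D X Y = (\<lambda>p f. D X Y p f - D Y X p f - lie_bracket X Y p f)"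

definition cov_deriv_metric ::
  "'a connection \<Rightarrow> 'a metric \<Rightarrow> 'a vfield \<Rightarrow> 'a vfield \<Rightarrow> 'a vfield \<Rightarrow> 'a \<Rightarrow> real" where
  "cov_deriv_metric D g X Y Z p =
     X p (\<lambda>q. g q (Y q) (Z q)) - g p (D X Y p) (Z p) - g p (Y p) (D X Z p)"

text \<open>Existence and uniqueness of the gradient vector follow from non-degeneracy of \<open>g\<close> and finite
  dimensionality of the tangent spaces; recall that \<open>d\<psi>(v) = v \<psi>\<close>.\<close>

definition grad :: "('a, 'e::euclidean_space) manifold \<Rightarrow> 'a metric \<Rightarrow> ('a \<Rightarrow> real) \<Rightarrow> 'a vfield" where
  "grad M g \<psi> = (\<lambda>p. if p \<in> points M
     then (THE u. u \<in> tangent_space M p \<and> (\<forall>v\<in>tangent_space M p. g p u v = v \<psi>))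
     else (\<lambda>f. 0))"

type_synonym 'a triple = "'a metric \<times> 'a form1 \<times> 'a connection"

fun SWMT :: "('a, 'e::euclidean_space) manifold \<Rightarrow> 'a triple \<Rightarrow> bool" where
  "SWMT M (g, \<eta>, D) \<longleftrightarrow>
     pseudo_riemannian_metric M g \<and> one_form M \<eta> \<and> affine_connection M D \<and>
     (\<forall>X\<in>vfields M. \<forall>Y\<in>vfields M. \<forall>Z\<in>vfields M. \<forall>p\<in>points M.
        cov_deriv_metric D g X Y Z p + \<eta> p (X p) * g p (Y p) (Z p) =
        cov_deriv_metric D g Y X Z p + \<eta> p (Y p) * g p (X p) (Z p) - g p (torsion D X Y p) (Z p))"

fun conf_proj_equiv :: "('a, 'e::euclidean_space) manifold \<Rightarrow> 'a triple \<Rightarrow> 'a triple \<Rightarrow> bool" where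
  "conf_proj_equiv M (g, \<eta>, D) (g2, \<eta>2, D2) \<longleftrightarrow>
     (\<forall>p\<in>points M. \<forall>u\<in>tangent_space M p. \<eta>2 p u = \<eta> p u) \<and>
     (\<exists>\<phi>\<in>smooth_funs M. \<exists>\<psi>\<in>smooth_funs M.
        (\<forall>p\<in>points M. \<forall>u\<in>tangent_space M p. \<forall>v\<in>tangent_space M p.
           g2 p u v = exp (\<phi> p + \<psi> p) * g p u v) \<and>
        (\<forall>X\<in>vfields M. \<forall>Y\<in>vfields M. \<forall>p\<in>points M.
           D2 X Y p = (\<lambda>f. D X Y p f + X p \<phi> * Y p f + Y p \<phi> * X p f
                           - g p (X p) (Y p) * grad M g \<psi> p f)))"

abbreviation incl :: "('a, 'e::euclidean_space) manifold \<Rightarrow> 'a tvec \<Rightarrow> 'a tvec" where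
  "incl M \<equiv> differential M (\<lambda>x. x)"

text \<open>A submanifold is a subset carrying a manifold structure for which the inclusion is an
  immersion.  Its topology may be finer than the subspace topology; it is an embedded submanifold
  if the two topologies agree.\<close>

definition smooth_submanifold ::
  "nat \<Rightarrow> ('a, 'f::euclidean_space) manifold \<Rightarrow> ('a, 'e::euclidean_space) manifold \<Rightarrow> bool" where
  "smooth_submanifold m M' M \<longleftrightarrow>
     smooth_manifold m M' \<and> points M' \<subseteq> points M \<and> smooth_map M' M (\<lambda>x. x) \<and>
     (\<forall>p\<in>points M'. inj_on (incl M) (tangent_space M' p))"

definition induced_metric :: "('a, 'e::euclidean_space) manifold \<Rightarrow> 'a metric \<Rightarrow> 'a metric" where
  "induced_metric M g = (\<lambda>p u v. g p (incl M u) (incl M v))"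

definition pseudo_riemannian_submanifold ::
  "nat \<Rightarrow> ('a, 'f::euclidean_space) manifold \<Rightarrow> ('a, 'e::euclidean_space) manifold \<Rightarrow> 'a metric \<Rightarrow> bool"
  where
  "pseudo_riemannian_submanifold m M' M g \<longleftrightarrow>
     smooth_submanifold m M' M \<and> pseudo_riemannian_metric M' (induced_metric M g)"

definition normal_space ::
  "('a, 'e::euclidean_space) manifold \<Rightarrow> ('a, 'f::euclidean_space) manifold \<Rightarrow> 'a metric \<Rightarrow> 'a
     \<Rightarrow> 'a tvec set" where
  "normal_space M M' g p =
     {w\<in>tangent_space M p. \<forall>v\<in>tangent_space M' p. g p w (incl M v) = 0}"

definition tangential ::
  "('a, 'e::euclidean_space) manifold \<Rightarrow> ('a, 'f::euclidean_space) manifold \<Rightarrow> 'a metric \<Rightarrow> 'a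
     \<Rightarrow> 'a tvec \<Rightarrow> 'a tvec" where
  "tangential M M' g p w =
     (THE u. u \<in> tangent_space M' p \<and>
        (\<exists>n\<in>normal_space M M' g p. w = (\<lambda>f. incl M u f + n f)))"

text \<open>For vector fields \<open>X\<close>, \<open>Y\<close> on the submanifold, the value of the ambient covariant derivative at a
  point \<open>p\<close> is, as usual, computed from vector fields on the ambient manifold that extend \<open>X\<close> and \<open>Y\<close>
  near \<open>p\<close>.  Such extensions exist, and the value at \<open>p\<close> does not depend on their choice.\<close>

definition extends_near ::
  "('a, 'e::euclidean_space) manifold \<Rightarrow> ('a, 'f::euclidean_space) manifold \<Rightarrow> 'a
     \<Rightarrow> 'a vfield \<Rightarrow> 'a vfield \<Rightarrow> bool" where
  "extends_near M M' p X Xe \<longleftrightarrow>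
     Xe \<in> vfields M \<and>
     (\<exists>W. openin (mtop M') W \<and> p \<in> W \<and> (\<forall>q\<in>W. Xe q = incl M (X q)))"

definition cov_deriv_along ::
  "('a, 'e::euclidean_space) manifold \<Rightarrow> ('a, 'f::euclidean_space) manifold \<Rightarrow> 'a connection
     \<Rightarrow> 'a connection" where
  "cov_deriv_along M M' D X Y p =
     D (SOME Xe. extends_near M M' p X Xe) (SOME Ye. extends_near M M' p Y Ye) p"

definition induced_connection ::
  "('a, 'e::euclidean_space) manifold \<Rightarrow> ('a, 'f::euclidean_space) manifold \<Rightarrow> 'a metric
     \<Rightarrow> 'a connection \<Rightarrow> 'a connection" where
  "induced_connection M M' g D X Y =
     (\<lambda>p. if p \<in> points M' then tangential M M' g p (cov_deriv_along M M' D X Y p) else (\<lambda>f. 0))"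

fun induced_triple ::
  "('a, 'e::euclidean_space) manifold \<Rightarrow> ('a, 'f::euclidean_space) manifold \<Rightarrow> 'a triple \<Rightarrow> 'a triple"
  where
  "induced_triple M M' (g, \<eta>, D) =
     (induced_metric M g, (\<lambda>p u. \<eta> p (incl M u)), induced_connection M M' g D)"

end

theory Submission
  imports Defs
begin

text \<open>The functions \<open>\<phi>\<close> and \<open>\<psi>\<close> of the ambient equivalence serve on the submanifold as well. The
  metrics \<open>g\<close> and \<open>e\<^sup>\<phi>\<^sup>+\<^sup>\<psi> g\<close> have the same normal spaces, hence the same tangential projection;
  this projection is linear, fixes tangent vectors of the submanifold and sends the ambient gradient
  of \<open>\<psi>\<close> to the intrinsic one, so it maps the ambient relation between the connections to the
  intrinsic relation.

  The junk values of the definitions are where the work lies. Projection and gradient exist because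
  a derivation is determined by its values on coordinate functions (Hadamard's lemma), so that
  tangent spaces are finite dimensional and non-degenerate forms represent functionals.  Vector
  fields on the submanifold extend locally because an immersion has a smooth local left inverse,
  by the inverse function theorem.\<close>

subsection \<open>Calculus of \<open>C\<^sup>k\<close> functions\<close>

text \<open>A chart takes values in a subspace of a Euclidean space, while differentiation lives on
  open sets of the whole space. A smooth function therefore has only local representatives on such
  open sets, with derivatives determined only in directions of the model space. This shapes the
  coordinate arguments: vectors are differentiated along the model space, orthogonal projections
  bring coordinate vectors back into it, and the square map fed to the inverse function theorem gets
  an extra summand on the orthogonal complement. Derivations act on globally defined functions, so
  everything local is cut off; extension by zero is smooth because a compact coordinate ball is
  closed in a Hausdorff space. The comparison of connections is made at one point:
  \<open>cov_deriv_along\<close> chooses the extensions of \<open>X\<close> and \<open>Y\<close>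
  without reference to metric or connection, so both induced connections evaluate the same two
  ambient fields, to which the ambient relation applies. Tangential parts are then compared through
  their pairings with vectors tangent to the submanifold.\<close>

lemma Ck_on_SucD: "Ck_on (Suc k) S f \<Longrightarrow> Ck_on k S f"
proof (induction k arbitrary: f)
  case 0
  then show ?case
    by (auto intro!: continuous_at_imp_continuous_on differentiable_imp_continuous_within)
next
  case (Suc k)
  have "Ck_on k S (\<lambda>x. frechet_derivative f (at x) v)" for v
    using Suc.prems by (intro Suc.IH) simp
  then show ?case using Suc.prems by simp
qed

lemma Ck_on_subset: "Ck_on k S f \<Longrightarrow> T \<subseteq> S \<Longrightarrow> Ck_on k T f"
  by (induction k arbitrary: f) (auto intro: continuous_on_subset)

text \<open>\<open>frechet_derivative\<close> looks at a full neighbourhood, so agreement on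
  \<open>S\<close> controls derivatives only because \<open>S\<close> is open.\<close>

lemma Ck_on_cong:
  assumes "open S" "\<And>x. x \<in> S \<Longrightarrow> f x = g x" "Ck_on k S f"
  shows "Ck_on k S g"
  using assms(2,3)
proof (induction k arbitrary: f g)
  case 0
  then show ?case using continuous_on_cong[of S S f g] by simp
next
  case (Suc k)
  have der: "(g has_derivative frechet_derivative f (at x)) (at x)" if "x \<in> S" for x
  proof (rule has_derivative_transform_within_open)
    show "(f has_derivative frechet_derivative f (at x)) (at x)"
      using Suc.prems(2) that frechet_derivative_works by auto
  qed (use \<open>open S\<close> that Suc.prems(1) in auto)
  have "Ck_on k S (\<lambda>x. frechet_derivative g (at x) v)" for v
  proof (rule Suc.IH)
    show "Ck_on k S (\<lambda>x. frechet_derivative f (at x) v)" using Suc.prems(2) by auto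
    show "frechet_derivative f (at x) v = frechet_derivative g (at x) v" if "x \<in> S" for x
      using frechet_derivative_at[OF der[OF that]] by simp
  qed
  then show ?case using der by (auto intro: differentiableI)
qed

text \<open>Uniqueness of derivatives lets any explicit derivative family replace the choice
  operator \<open>frechet_derivative\<close>. Each direction \<open>v\<close> is fixed in turn, as
  in the definition of \<open>Ck_on\<close>.\<close>

lemma Ck_on_SucI:
  assumes "open S" "\<And>x. x \<in> S \<Longrightarrow> (f has_derivative f' x) (at x)"
    and "\<And>v. Ck_on k S (\<lambda>x. f' x v)"
  shows "Ck_on (Suc k) S f"
proof -
  have "Ck_on k S (\<lambda>x. frechet_derivative f (at x) v)" for v
    using Ck_on_cong[OF assms(1) _ assms(3)[of v]] frechet_derivative_at[OF assms(2)] by simp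
  then show ?thesis using assms(2) by (auto intro: differentiableI)
qed

lemma Ck_on_Suc_has_derivative:
  "Ck_on (Suc k) S f \<Longrightarrow> x \<in> S \<Longrightarrow> (f has_derivative frechet_derivative f (at x)) (at x)"
  using frechet_derivative_works by auto

lemma Ck_on_const: "open S \<Longrightarrow> Ck_on k S (\<lambda>x. c)"
proof (induction k arbitrary: c)
  case (Suc k)
  then show ?case by (intro Ck_on_SucI[where f' = "\<lambda>x v. 0"]) auto
qed auto

lemma Ck_on_bounded_linear:
  assumes "bounded_linear L" "open S" shows "Ck_on k S L"
proof (cases k)
  case 0
  then show ?thesis using assms by (simp add: linear_continuous_on)
next
  case (Suc j)
  show ?thesis unfolding Suc using assms
    by (intro Ck_on_SucI[where f' = "\<lambda>x. L"] bounded_linear_imp_has_derivative Ck_on_const)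
qed

lemma Ck_on_linear_compose:
  assumes "bounded_linear L" "open S" "Ck_on k S f"
  shows "Ck_on k S (\<lambda>x. L (f x))"
  using assms(3)
proof (induction k arbitrary: f)
  case 0
  then show ?case using assms(1) by (auto intro: bounded_linear.continuous_on)
next
  case (Suc k)
  show ?case
  proof (rule Ck_on_SucI[OF \<open>open S\<close>])
    show "((\<lambda>x. L (f x)) has_derivative (\<lambda>v. L (frechet_derivative f (at x) v))) (at x)"
      if "x \<in> S" for x
      using bounded_linear.has_derivative[OF assms(1) Ck_on_Suc_has_derivative[OF Suc.prems that]] .
    show "Ck_on k S (\<lambda>x. L (frechet_derivative f (at x) v))" for v
      using Suc by auto
  qed
qed

lemma Ck_on_add:
  assumes "open S" "Ck_on k S f" "Ck_on k S g"
  shows "Ck_on k S (\<lambda>x. f x + g x)"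
  using assms(2,3)
proof (induction k arbitrary: f g)
  case 0
  then show ?case by (simp add: continuous_on_add)
next
  case (Suc k)
  show ?case
  proof (rule Ck_on_SucI[OF \<open>open S\<close>])
    show "((\<lambda>x. f x + g x) has_derivative
        (\<lambda>v. frechet_derivative f (at x) v + frechet_derivative g (at x) v)) (at x)"
      if "x \<in> S" for x
      using Suc.prems that by (intro has_derivative_add Ck_on_Suc_has_derivative)
    show "Ck_on k S (\<lambda>x. frechet_derivative f (at x) v + frechet_derivative g (at x) v)" for v
      using Suc by auto
  qed
qed

text \<open>The product rule stays inside the same bilinear map, so the induction closes once the
  undifferentiated factor is lowered by one order. Real products, scalar multiples, inner products
  and operator composition are all instances.\<close>

lemma Ck_on_bilinear:
  assumes "bounded_bilinear pr" "open S" "Ck_on k S f" "Ck_on k S g"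
  shows "Ck_on k S (\<lambda>x. pr (f x) (g x))"
  using assms(3,4)
proof (induction k arbitrary: f g)
  case 0
  then show ?case using assms(1) by (auto intro: bounded_bilinear.continuous_on)
next
  case (Suc k)
  show ?case
  proof (rule Ck_on_SucI[OF \<open>open S\<close>])
    show "((\<lambda>x. pr (f x) (g x)) has_derivative (\<lambda>v. pr (f x) (frechet_derivative g (at x) v)
        + pr (frechet_derivative f (at x) v) (g x))) (at x)"
      if "x \<in> S" for x
      using Suc.prems that
      by (intro bounded_bilinear.FDERIV[OF assms(1)] Ck_on_Suc_has_derivative)
    show "Ck_on k S (\<lambda>x. pr (f x) (frechet_derivative g (at x) v)
        + pr (frechet_derivative f (at x) v) (g x))" for v
      using Suc.prems Ck_on_SucD[OF Suc.prems(1)] Ck_on_SucD[OF Suc.prems(2)]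
      by (intro Ck_on_add Suc.IH assms) auto
  qed
qed

lemma Ck_on_sum:
  assumes "open S" "\<And>i. i \<in> I \<Longrightarrow> Ck_on k S (f i)"
  shows "Ck_on k S (\<lambda>x. \<Sum>i\<in>I. f i x)"
  using assms(2)
  by (induction I rule: infinite_finite_induct) (auto intro!: Ck_on_const Ck_on_add assms(1))

lemma Ck_on_compose:
  assumes "open S" "open T" "Ck_on k T g" "Ck_on k S f" "\<And>x. x \<in> S \<Longrightarrow> f x \<in> T"
  shows "Ck_on k S (\<lambda>x. g (f x))"
  using assms(3,4)
proof (induction k arbitrary: g)
  case 0
  then show ?case
    using assms(5) by (auto intro!: continuous_on_compose2[of T g S f])
next
  case (Suc k)
  \<comment> \<open>The chain rule evaluates the derivative of \<open>g\<close> in the moving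
    direction \<open>frechet_derivative f (at x) v\<close>, whereas the induction hypothesis speaks
    of fixed directions. Expanding in \<open>Basis\<close> separates the two.\<close>
  let ?h = "\<lambda>x v. \<Sum>b\<in>Basis. (frechet_derivative f (at x) v \<bullet> b) *\<^sub>R frechet_derivative g (at (f x)) b"
  show ?case
  proof (rule Ck_on_SucI[OF \<open>open S\<close>])
    fix x assume x: "x \<in> S"
    have "linear (frechet_derivative g (at (f x)))"
      using Suc.prems(1) x assms(5) by (intro linear_frechet_derivative) auto
    then have "frechet_derivative g (at (f x)) w =
        (\<Sum>b\<in>Basis. (w \<bullet> b) *\<^sub>R frechet_derivative g (at (f x)) b)" for w
      by (subst (1) euclidean_representation[of w, symmetric]) (simp add: linear_sum linear_scale)
    then have *: "frechet_derivative g (at (f x)) =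
        (\<lambda>w. \<Sum>b\<in>Basis. (w \<bullet> b) *\<^sub>R frechet_derivative g (at (f x)) b)" by blast
    have "((\<lambda>x. g (f x)) has_derivative
        (\<lambda>v. frechet_derivative g (at (f x)) (frechet_derivative f (at x) v))) (at x)"
      by (rule has_derivative_compose[OF Ck_on_Suc_has_derivative[OF Suc.prems(2) x]
            Ck_on_Suc_has_derivative[OF Suc.prems(1) assms(5)[OF x]]])
    then show "((\<lambda>x. g (f x)) has_derivative ?h x) (at x)"
      by (subst (asm) *)
  next
    fix v
    show "Ck_on k S (\<lambda>x. ?h x v)"
    proof (intro Ck_on_sum Ck_on_bilinear[OF bounded_bilinear_scaleR] assms(1))
      fix b :: 'b
      show "Ck_on k S (\<lambda>x. frechet_derivative f (at x) v \<bullet> b)"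
        using Suc.prems(2) by (intro Ck_on_linear_compose[OF bounded_linear_inner_left] assms(1)) auto
      show "Ck_on k S (\<lambda>x. frechet_derivative g (at (f x)) b)"
        using Suc.prems(1) Ck_on_SucD[OF Suc.prems(2)] by (intro Suc.IH) auto
    qed
  qed
qed

section \<open>Infinitely differentiable functions on open sets\<close>

definition smooth_on_open :: "'e::euclidean_space set \<Rightarrow> ('e \<Rightarrow> 'b::real_normed_vector) \<Rightarrow> bool" where
  "smooth_on_open S f \<longleftrightarrow> open S \<and> (\<forall>k. Ck_on k S f)"

lemma smooth_on_open_subset: "smooth_on_open S f \<Longrightarrow> open T \<Longrightarrow> T \<subseteq> S \<Longrightarrow> smooth_on_open T f"
  by (auto simp: smooth_on_open_def intro: Ck_on_subset)

lemma smooth_on_open_cong: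
  "smooth_on_open S f \<Longrightarrow> (\<And>x. x \<in> S \<Longrightarrow> f x = g x) \<Longrightarrow> smooth_on_open S g"
  by (auto simp: smooth_on_open_def intro: Ck_on_cong)

lemma smooth_on_open_continuous: "smooth_on_open S f \<Longrightarrow> continuous_on S f"
  unfolding smooth_on_open_def using Ck_on.simps(1) by metis

lemma smooth_on_open_has_derivative:
  "smooth_on_open S f \<Longrightarrow> x \<in> S \<Longrightarrow> (f has_derivative frechet_derivative f (at x)) (at x)"
  unfolding smooth_on_open_def using Ck_on_Suc_has_derivative by blast

lemma smooth_on_open_directional:
  assumes "smooth_on_open S f"
  shows "smooth_on_open S (\<lambda>x. frechet_derivative f (at x) v)"
proof -
  have "Ck_on (Suc k) S f" for k using assms smooth_on_open_def by blast
  then show ?thesis using assms by (simp add: smooth_on_open_def)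
qed

lemma smooth_on_open_const: "open S \<Longrightarrow> smooth_on_open S (\<lambda>x. c)"
  by (simp add: smooth_on_open_def Ck_on_const)

lemma smooth_on_open_linear: "bounded_linear L \<Longrightarrow> open S \<Longrightarrow> smooth_on_open S L"
  by (simp add: smooth_on_open_def Ck_on_bounded_linear)

lemma smooth_on_open_linear_compose:
  "bounded_linear L \<Longrightarrow> smooth_on_open S f \<Longrightarrow> smooth_on_open S (\<lambda>x. L (f x))"
  by (simp add: smooth_on_open_def Ck_on_linear_compose)

lemma smooth_on_open_add:
  "smooth_on_open S f \<Longrightarrow> smooth_on_open S g \<Longrightarrow> smooth_on_open S (\<lambda>x. f x + g x)"
  by (simp add: smooth_on_open_def Ck_on_add)

lemma smooth_on_open_bilinear:
  "bounded_bilinear pr \<Longrightarrow> smooth_on_open S f \<Longrightarrow> smooth_on_open S g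
    \<Longrightarrow> smooth_on_open S (\<lambda>x. pr (f x) (g x))"
  by (simp add: smooth_on_open_def Ck_on_bilinear)

lemma smooth_on_open_sum:
  "open S \<Longrightarrow> (\<And>i. i \<in> I \<Longrightarrow> smooth_on_open S (f i)) \<Longrightarrow> smooth_on_open S (\<lambda>x. \<Sum>i\<in>I. f i x)"
  by (simp add: smooth_on_open_def Ck_on_sum)

lemma smooth_on_open_compose:
  "smooth_on_open T g \<Longrightarrow> smooth_on_open S f \<Longrightarrow> (\<And>x. x \<in> S \<Longrightarrow> f x \<in> T)
    \<Longrightarrow> smooth_on_open S (\<lambda>x. g (f x))"
  unfolding smooth_on_open_def by (metis Ck_on_compose)

lemma smooth_on_open_diff:
  fixes f g :: "'a::euclidean_space \<Rightarrow> 'b::real_normed_vector"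
  assumes "smooth_on_open S f" "smooth_on_open S g"
  shows "smooth_on_open S (\<lambda>x. f x - g x)"
  using smooth_on_open_add[OF assms(1) smooth_on_open_linear_compose[OF _ assms(2), of uminus]]
  by (simp add: bounded_linear_minus)

text \<open>The derivative of \<open>1/f\<close> is a polynomial in \<open>1/f\<close> and the
  derivative of \<open>f\<close>, so each order of smoothness of \<open>1/f\<close> yields the
  next.\<close>

lemma smooth_on_open_inverse:
  fixes f :: "'e::euclidean_space \<Rightarrow> real"
  assumes "smooth_on_open S f" "\<And>x. x \<in> S \<Longrightarrow> f x \<noteq> 0"
  shows "smooth_on_open S (\<lambda>x. inverse (f x))"
proof -
  have S: "open S" and f: "\<And>k. Ck_on k S f" using assms(1) by (auto simp: smooth_on_open_def)
  have "Ck_on k S (\<lambda>x. inverse (f x))" for k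
  proof (induction k)
    case 0
    then show ?case
      using smooth_on_open_continuous[OF assms(1)] assms(2) by (simp add: continuous_on_inverse)
  next
    case (Suc k)
    show ?case
    proof (rule Ck_on_SucI[OF S])
      show "((\<lambda>x. inverse (f x)) has_derivative (\<lambda>v. - 1 *\<^sub>R
          (inverse (f x) * (frechet_derivative f (at x) v * inverse (f x))))) (at x)" if "x \<in> S" for x
        using assms(2)[OF that] smooth_on_open_has_derivative[OF assms(1) that]
        by (auto intro!: derivative_eq_intros simp: algebra_simps)
      show "Ck_on k S (\<lambda>x. - 1 *\<^sub>R (inverse (f x) * (frechet_derivative f (at x) v * inverse (f x))))"
        for v
        using Suc f[of "Suc k"]
        by (intro Ck_on_linear_compose[OF bounded_linear_scaleR_right] S
            Ck_on_bilinear[OF bounded_bilinear_mult]) auto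
    qed
  qed
  then show ?thesis using S by (simp add: smooth_on_open_def)
qed

section \<open>Operator inversion and the smooth inverse function theorem\<close>

text \<open>Where one factor vanishes, continuity of the other suffices for the product rule: the
  term with a derivative of \<open>c\<close> would be multiplied by \<open>r x = 0\<close>. This
  allows an inverse to be differentiated as soon as it is known to be continuous.\<close>

lemma has_derivative_bilinear_zero:
  fixes pr :: "'b::real_normed_vector \<Rightarrow> 'c::real_normed_vector \<Rightarrow> 'd::real_normed_vector"
    and x :: "'a::real_normed_vector"
  assumes pr: "bounded_bilinear pr" and c: "isCont c x" and r: "(r has_derivative r') (at x)"
    and r0: "r x = 0"
  shows "((\<lambda>y. pr (c y) (r y)) has_derivative (\<lambda>v. pr (c x) (r' v))) (at x)"
proof (rule has_derivativeI)
  interpret pr: bounded_bilinear pr by fact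
  interpret r': bounded_linear r' using r by (rule has_derivative_bounded_linear)
  show "bounded_linear (\<lambda>v. pr (c x) (r' v))"
    using bounded_linear_compose[OF pr.bounded_linear_right r'.bounded_linear_axioms] .
  \<comment> \<open>The difference quotient is split into \<open>1\<close>, which carries the
    remainder of \<open>r\<close>, and \<open>2\<close>, where the factor \<open>c y - c x\<close>
    tending to 0 meets a bounded normalised value of \<open>r'\<close>.\<close>
  have 1: "((\<lambda>y. pr (c y) (((r y - r x) - r' (y - x)) /\<^sub>R norm (y - x))) \<longlongrightarrow> pr (c x) 0) (at x)"
    using c r by (intro pr.tendsto) (auto simp: isCont_def has_derivative_at_within)
  have 2: "((\<lambda>y. pr (c y - c x) (r' (y - x) /\<^sub>R norm (y - x))) \<longlongrightarrow> 0) (at x)"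
  proof -
    obtain K where K: "\<And>a b. norm (pr a b) \<le> norm a * norm b * K" "0 < K" using pr.pos_bounded by auto
    obtain K' where K': "\<And>v. norm (r' v) \<le> norm v * K'" "0 < K'" using r'.pos_bounded by auto
    have b: "norm (r' (y - x) /\<^sub>R norm (y - x)) \<le> K'" for y
      using K'(1)[of "y - x"] K'(2) by (cases "y = x") (auto simp: field_simps r'.zero)
    show ?thesis
    proof (rule Lim_null_comparison)
      show "\<forall>\<^sub>F y in at x. norm (pr (c y - c x) (r' (y - x) /\<^sub>R norm (y - x)))
          \<le> norm (c y - c x) * K' * K"
      proof (intro always_eventually allI)
        fix y
        show "norm (pr (c y - c x) (r' (y - x) /\<^sub>R norm (y - x))) \<le> norm (c y - c x) * K' * K"
          using K(1)[of "c y - c x" "r' (y - x) /\<^sub>R norm (y - x)"] b[of y] K(2)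
          by (meson mult_left_mono mult_right_mono norm_ge_zero order_trans less_imp_le)
      qed
      have "((\<lambda>y. norm (c y - c x) * K' * K) \<longlongrightarrow> norm (c x - c x) * K' * K) (at x)"
        using c unfolding isCont_def by (intro tendsto_intros)
      then show "((\<lambda>y. norm (c y - c x) * K' * K) \<longlongrightarrow> 0) (at x)" by simp
    qed
  qed
  have "((\<lambda>y. pr (c y) (((r y - r x) - r' (y - x)) /\<^sub>R norm (y - x))
      + pr (c y - c x) (r' (y - x) /\<^sub>R norm (y - x))) \<longlongrightarrow> pr (c x) 0 + 0) (at x)"
    by (rule tendsto_add[OF 1 2])
  moreover have "pr (c y) (((r y - r x) - r' (y - x)) /\<^sub>R norm (y - x))
      + pr (c y - c x) (r' (y - x) /\<^sub>R norm (y - x))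
      = ((pr (c y) (r y) - pr (c x) (r x)) - pr (c x) (r' (y - x))) /\<^sub>R norm (y - x)" for y
    by (simp add: pr.scaleR_right pr.diff_left pr.diff_right r0 pr.zero_right algebra_simps)
  ultimately show "((\<lambda>y. ((pr (c y) (r y) - pr (c x) (r x)) - pr (c x) (r' (y - x))) /\<^sub>R norm (y - x))
      \<longlongrightarrow> 0) (at x)"
    by (simp add: pr.zero_right)
qed

text \<open>The identity \<open>eq\<close>, a form of the resolvent identity, controls everything:
  it bounds \<open>C\<close> locally, then gives continuity, and then the derivative, because its
  last term carries the factor \<open>B y - B x\<close> that vanishes at \<open>y = x\<close>. The
  derivative formula contains only \<open>C\<close> and the derivative of \<open>B\<close>, so
  smoothness follows by induction on the order.\<close>

lemma smooth_on_open_blinfun_inverse: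
  fixes B :: "'e::euclidean_space \<Rightarrow> 'c::real_normed_vector \<Rightarrow>\<^sub>L 'd::real_normed_vector"
  assumes B: "smooth_on_open S B"
    and CB: "\<And>x. x \<in> S \<Longrightarrow> C x o\<^sub>L B x = id_blinfun" and BC: "\<And>x. x \<in> S \<Longrightarrow> B x o\<^sub>L C x = id_blinfun"
  shows "smooth_on_open S C"
proof -
  have S: "open S" and Bk: "\<And>k. Ck_on k S B" using B by (auto simp: smooth_on_open_def)
  have eq: "C y = C x - (C y o\<^sub>L ((B y - B x) o\<^sub>L C x))" if x: "x \<in> S" and y: "y \<in> S" for x y
  proof -
    have cb: "C y (B y z) = z" "B x (C x z') = z'" for z :: 'c and z' :: 'd
      using arg_cong[OF CB[OF y], of "\<lambda>F. blinfun_apply F z"]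
        arg_cong[OF BC[OF x], of "\<lambda>F. blinfun_apply F z'"] by auto
    show ?thesis
      by (rule blinfun_eqI) (simp add: blinfun.bilinear_simps cb)
  qed
  have C: "continuous_on S C"
  proof (rule continuous_at_imp_continuous_on, rule)
    fix x assume x: "x \<in> S"
    have BS: "(B \<longlongrightarrow> B x) (at x)"
      using smooth_on_open_continuous[OF B] S x
      by (simp add: continuous_on_eq_continuous_at isCont_def)
    let ?d = "\<lambda>y. norm (B y - B x)"
    have "((\<lambda>y. ?d y * norm (C x)) \<longlongrightarrow> norm (B x - B x) * norm (C x)) (at x)"
      by (intro tendsto_intros BS)
    \<comment> \<open>The bound \<open>1/2\<close> lets the term with \<open>norm (C y)\<close> on
      the right be absorbed on the left, which gives
      \<open>norm (C y) \<le> 2 * norm (C x)\<close>.\<close>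
    then have "\<forall>\<^sub>F y in at x. ?d y * norm (C x) < 1/2"
      by (rule order_tendstoD) simp
    then have bd: "\<forall>\<^sub>F y in at x. norm (C y - C x) \<le> 2 * norm (C x) * (?d y * norm (C x))"
      using eventually_at_in_open'[OF S x]
    proof eventually_elim
      case (elim y)
      have n: "norm (C y o\<^sub>L ((B y - B x) o\<^sub>L C x)) \<le> norm (C y) * (?d y * norm (C x))"
        by (meson mult_left_mono norm_blinfun_compose norm_ge_zero order_trans)
      have "norm (C y) \<le> norm (C x) + norm (C y o\<^sub>L ((B y - B x) o\<^sub>L C x))"
        using eq[OF x elim(2)] norm_triangle_ineq4 by metis
      also have "\<dots> \<le> norm (C x) + norm (C y) * (1/2)"
        by (intro add_left_mono order_trans[OF n] mult_left_mono) (use elim(1) in auto)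
      finally have "norm (C y) \<le> 2 * norm (C x)" by simp
      then have "norm (C y) * (?d y * norm (C x)) \<le> 2 * norm (C x) * (?d y * norm (C x))"
        by (intro mult_right_mono) auto
      moreover have "norm (C y - C x) = norm (C y o\<^sub>L ((B y - B x) o\<^sub>L C x))"
        using eq[OF x elim(2)] by (metis add_diff_cancel_left' diff_add_cancel minus_diff_eq norm_minus_cancel)
      ultimately show ?case using n by linarith
    qed
    have "((\<lambda>y. 2 * norm (C x) * (?d y * norm (C x))) \<longlongrightarrow>
        2 * norm (C x) * (norm (B x - B x) * norm (C x))) (at x)"
      by (intro tendsto_intros BS)
    then have "((\<lambda>y. 2 * norm (C x) * (?d y * norm (C x))) \<longlongrightarrow> 0) (at x)" by simp
    from Lim_null_comparison[OF bd this] show "isCont C x"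
      unfolding isCont_def by (rule LIM_zero_cancel)
  qed
  have der: "(C has_derivative (\<lambda>v. - 1 *\<^sub>R (C x o\<^sub>L (frechet_derivative B (at x) v o\<^sub>L C x)))) (at x)"
    if x: "x \<in> S" for x
  proof -
    let ?R = "\<lambda>y. (B y - B x) o\<^sub>L C x"
    let ?R' = "\<lambda>v. frechet_derivative B (at x) v o\<^sub>L C x"
    have R: "(?R has_derivative ?R') (at x)"
      by (rule bounded_linear.has_derivative[OF bounded_bilinear.bounded_linear_left
              [OF bounded_bilinear_blinfun_compose]])
         (use smooth_on_open_has_derivative[OF B x] in \<open>auto intro!: derivative_eq_intros\<close>)
    have cC: "isCont C x" using C S x by (simp add: continuous_on_eq_continuous_at)
    have "((\<lambda>y. C y o\<^sub>L ?R y) has_derivative (\<lambda>v. C x o\<^sub>L ?R' v)) (at x)"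
      by (rule has_derivative_bilinear_zero[OF bounded_bilinear_blinfun_compose cC R]) simp
    then have "((\<lambda>y. C x - (C y o\<^sub>L ?R y)) has_derivative (\<lambda>v. 0 - (C x o\<^sub>L ?R' v))) (at x)"
      by (intro has_derivative_diff has_derivative_const)
    then have "((\<lambda>y. C x - (C y o\<^sub>L ?R y)) has_derivative (\<lambda>v. - 1 *\<^sub>R (C x o\<^sub>L ?R' v))) (at x)"
      by simp
    then show ?thesis
      by (rule has_derivative_transform_within_open[OF _ S x]) (use eq[OF x] in auto)
  qed
  have "Ck_on k S C" for k
  proof (induction k)
    case 0
    then show ?case using C by auto
  next
    case (Suc k)
    show ?case
    proof (rule Ck_on_SucI[OF S der])
      show "Ck_on k S (\<lambda>x. - 1 *\<^sub>R (C x o\<^sub>L (frechet_derivative B (at x) v o\<^sub>L C x)))" for v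
        using Suc Bk[of "Suc k"]
        by (intro Ck_on_linear_compose[OF bounded_linear_scaleR_right] S
            Ck_on_bilinear[OF bounded_bilinear_blinfun_compose]) auto
    qed
  qed
  then show ?thesis using S by (simp add: smooth_on_open_def)
qed


text \<open>\<open>Ck_on\<close> knows only directional derivatives, while the inverse function
  theorem and differentiation under the integral ask for a derivative continuous in operator norm.
  In finite dimension the operator is a finite sum over \<open>Basis\<close> of directional
  derivatives times coordinate functionals.\<close>

lemma smooth_on_open_Blinfun:
  fixes f :: "'e::euclidean_space \<Rightarrow> 'b::real_normed_vector"
  assumes "smooth_on_open S f"
  shows "smooth_on_open S (\<lambda>x. Blinfun (frechet_derivative f (at x)))"
proof -
  let ?T = "\<lambda>x. \<Sum>b\<in>Basis. blinfun_scaleR_left (frechet_derivative f (at x) b) o\<^sub>L blinfun_inner_right b"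
  have S: "open S" using assms by (simp add: smooth_on_open_def)
  have "smooth_on_open S ?T"
    using S by (intro smooth_on_open_sum S smooth_on_open_linear_compose[OF _ smooth_on_open_directional[OF assms],
        where L = "\<lambda>c. blinfun_scaleR_left c o\<^sub>L blinfun_inner_right b" for b]
        bounded_linear_compose[OF bounded_bilinear.bounded_linear_left[OF bounded_bilinear_blinfun_compose]
          bounded_linear_blinfun_scaleR_left])
  moreover have "?T x = Blinfun (frechet_derivative f (at x))" if "x \<in> S" for x
  proof (rule blinfun_eqI)
    fix v
    have bl: "bounded_linear (frechet_derivative f (at x))"
      using smooth_on_open_has_derivative[OF assms that] has_derivative_bounded_linear by blast
    then have l: "linear (frechet_derivative f (at x))" by (rule bounded_linear.linear)
    have "blinfun_apply (?T x) v = (\<Sum>b\<in>Basis. (v \<bullet> b) *\<^sub>R frechet_derivative f (at x) b)"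
      by (simp add: blinfun.sum_left inner_commute)
    also have "\<dots> = frechet_derivative f (at x) v"
      using linear_sum[OF l, of "\<lambda>b. (v \<bullet> b) *\<^sub>R b" Basis]
      by (simp add: linear_scale[OF l] euclidean_representation)
    finally show "blinfun_apply (?T x) v = blinfun_apply (Blinfun (frechet_derivative f (at x))) v"
      by (simp add: bounded_linear_Blinfun_apply[OF bl])
  qed
  ultimately show ?thesis by (rule smooth_on_open_cong)
qed

text \<open>\<open>inverse_function_theorem\<close> supplies an inverse \<open>g\<close> whose
  derivative at \<open>y\<close> is the inverse of the derivative of \<open>f\<close> at
  \<open>g y\<close>. As operator inversion is smooth, this is a smooth map composed with
  \<open>g\<close>, so \<open>g\<close> of class \<open>C^k\<close> is of class
  \<open>C^(k+1)\<close>.\<close>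

lemma smooth_inverse_function:
  fixes f :: "'e::euclidean_space \<Rightarrow> 'e"
  assumes f: "smooth_on_open U f" and x0: "x0 \<in> U" and inj: "inj (frechet_derivative f (at x0))"
  obtains U' V g where "open U'" "U' \<subseteq> U" "x0 \<in> U'" "f x0 \<in> V" "smooth_on_open V g"
    "\<forall>x\<in>U'. f x \<in> V \<and> g (f x) = x" "g ` V \<subseteq> U'"
proof -
  let ?B = "\<lambda>x. Blinfun (frechet_derivative f (at x))"
  have B: "smooth_on_open U ?B" by (rule smooth_on_open_Blinfun[OF f])
  have U: "open U" using f by (simp add: smooth_on_open_def)
  have bl: "bounded_linear (frechet_derivative f (at x))" if "x \<in> U" for x
    using smooth_on_open_has_derivative[OF f that] has_derivative_bounded_linear by blast
  have Bx: "blinfun_apply (?B x) = frechet_derivative f (at x)" if "x \<in> U" for x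
    using bounded_linear_Blinfun_apply[OF bl[OF that]] .
  obtain i where i: "linear i" "i \<circ> frechet_derivative f (at x0) = id"
    using linear_injective_left_inverse[OF bounded_linear.linear[OF bl[OF x0]] inj] by blast
  have "Blinfun i o\<^sub>L ?B x0 = id_blinfun"
    using i(2) by (intro blinfun_eqI) (simp add: bounded_linear_Blinfun_apply[OF linear_conv_bounded_linear[THEN iffD1, OF i(1)]]
      Bx[OF x0] o_def id_def fun_eq_iff)
  then obtain U' V g g' where *: "open U'" "U' \<subseteq> U" "x0 \<in> U'" "open V" "f x0 \<in> V" "homeomorphism U' V f g"
    "\<And>y. y \<in> V \<Longrightarrow> (g has_derivative (g' y)) (at y)"
    "\<And>y. y \<in> V \<Longrightarrow> g' y = inv (blinfun_apply (?B (g y)))"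
    "\<And>y. y \<in> V \<Longrightarrow> bij (blinfun_apply (?B (g y)))"
    using inverse_function_theorem[OF U _ smooth_on_open_continuous[OF B] x0] Bx
      smooth_on_open_has_derivative[OF f] by (metis (no_types, lifting))
  have gU: "g y \<in> U'" if "y \<in> V" for y using *(6) that by (auto simp: homeomorphism_def)
  have fV: "f x \<in> V \<and> g (f x) = x" if "x \<in> U'" for x using *(6) that by (auto simp: homeomorphism_def)
  have bij: "bij (blinfun_apply (?B x))" if "x \<in> U'" for x
    using *(9) fV[OF that] by metis
  define C where "C x = Blinfun (inv (blinfun_apply (?B x)))" for x
  have C: "blinfun_apply (C x) = inv (blinfun_apply (?B x))" if "x \<in> U'" for x
  proof -
    have "linear (inv (blinfun_apply (?B x)))"
      using bij[OF that] blinfun.bounded_linear_right bounded_linear.linear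
      by (metis bij_is_inj inj_linear_imp_inv_linear)
    then show ?thesis unfolding C_def
      by (simp add: bounded_linear_Blinfun_apply linear_conv_bounded_linear)
  qed
  have Cs: "smooth_on_open U' C"
  proof (rule smooth_on_open_blinfun_inverse[OF smooth_on_open_subset[OF B *(1,2)]])
    show "C x o\<^sub>L ?B x = id_blinfun" if "x \<in> U'" for x
      using bij[OF that] by (intro blinfun_eqI) (simp add: C[OF that] bij_is_inj)
    show "?B x o\<^sub>L C x = id_blinfun" if "x \<in> U'" for x
      using bij[OF that] by (intro blinfun_eqI) (simp add: C[OF that] bij_is_surj surj_f_inv_f)
  qed
  have "Ck_on k V g" for k
  proof (induction k)
    case 0
    show ?case using *(6) by (simp add: homeomorphism_def)
  next
    case (Suc k)
    show ?case
    proof (rule Ck_on_SucI[OF *(4)])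
      show "(g has_derivative blinfun_apply (C (g y))) (at y)" if "y \<in> V" for y
        using *(7,8)[OF that] C[OF gU[OF that]] by simp
      show "Ck_on k V (\<lambda>y. blinfun_apply (C (g y)) v)" for v
        using Cs gU Suc *(1,4) unfolding smooth_on_open_def
        by (intro Ck_on_linear_compose[where L = "\<lambda>c. blinfun_apply c v"] blinfun.bounded_linear_left)
          (auto intro: Ck_on_compose[of V U' k C g])
    qed
  qed
  then have "smooth_on_open V g" using *(4) by (simp add: smooth_on_open_def)
  then show ?thesis using that *(1,2,3,5) fV gU by (metis image_subsetI)
qed

section \<open>Bump functions\<close>

text \<open>For \<open>n = 0\<close> this is the classical smooth function that is flat at the
  origin. The powers in the denominator make the family closed under differentiation up to linear
  combinations, so that one induction on the order treats all \<open>n\<close> together.\<close>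

definition flat :: "nat \<Rightarrow> real \<Rightarrow> real" where
  "flat n t = (if t \<le> 0 then 0 else exp (- (1 / t)) / t ^ n)"

lemma flat_has_derivative:
  "(flat n has_derivative (\<lambda>v. v * (flat (n + 2) t + - real n * flat (n + 1) t))) (at t)"
proof -
  consider "t < 0" | "t > 0" | "t = 0" by linarith
  then have "(flat n has_field_derivative (flat (n + 2) t + - real n * flat (n + 1) t)) (at t)"
  proof cases
    case 1
    have "((\<lambda>t. 0) has_field_derivative (flat (n + 2) t + - real n * flat (n + 1) t)) (at t)"
      using 1 by (simp add: flat_def)
    then show ?thesis
      by (rule has_field_derivative_transform_within_open[of _ _ _ "{..<0}"]) (use 1 in \<open>auto simp: flat_def\<close>)
  next
    case 2
    have "((\<lambda>t. exp (- (1 / t)) / t ^ n) has_field_derivative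
        (exp (- (1 / t)) * (1 / t\<^sup>2) * t ^ n - exp (- (1 / t)) * (real n * t ^ (n - 1))) / (t ^ n * t ^ n)) (at t)"
      using 2 by (auto intro!: derivative_eq_intros simp: power2_eq_square)
    moreover have "(exp (- (1 / t)) * (1 / t\<^sup>2) * t ^ n - exp (- (1 / t)) * (real n * t ^ (n - 1))) / (t ^ n * t ^ n)
        = flat (n + 2) t + - real n * flat (n + 1) t"
      using 2 by (cases n) (simp_all add: flat_def field_simps power2_eq_square)
    ultimately have "((\<lambda>t. exp (- (1 / t)) / t ^ n) has_field_derivative
        flat (n + 2) t + - real n * flat (n + 1) t) (at t)" by simp
    then show ?thesis
      by (rule has_field_derivative_transform_within_open[of _ _ _ "{0<..}"]) (use 2 in \<open>auto simp: flat_def\<close>)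
  next
    case 3
    \<comment> \<open>From the left the quotient vanishes; from the right, with
      \<open>s = 1/h\<close>, it is \<open>s^(n+1) / exp s\<close>, and the exponential outgrows
      every power.\<close>
    have lim: "((\<lambda>h. flat n h / h) \<longlongrightarrow> 0) (at 0)"
    proof (rule filterlim_split_at)
      show "((\<lambda>h. flat n h / h) \<longlongrightarrow> 0) (at_left 0)"
        by (rule tendsto_eventually) (auto simp: flat_def eventually_at_left_field intro: exI[of _ "-1"])
      have "((\<lambda>h. inverse h ^ Suc n / exp (inverse h)) \<longlongrightarrow> (0::real)) (at_right 0)"
        by (rule filterlim_compose[OF tendsto_power_div_exp_0 filterlim_inverse_at_top_right])
      moreover have "\<forall>\<^sub>F h::real in at_right 0. inverse h ^ Suc n / exp (inverse h) = flat n h / h"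
        using eventually_at_right_less[of 0]
        by eventually_elim (simp add: flat_def exp_minus field_simps)
      ultimately show "((\<lambda>h. flat n h / h) \<longlongrightarrow> 0) (at_right 0)"
        by (rule Lim_transform_eventually)
    qed
    have "(flat n has_field_derivative 0) (at 0)"
      unfolding DERIV_def using lim by (simp add: flat_def[of n 0])
    then show ?thesis using 3 by (simp add: flat_def)
  qed
  then show ?thesis
    unfolding has_field_derivative_def by (rule has_derivative_eq_rhs) (simp add: fun_eq_iff)
qed

lemma flat_smooth: "smooth_on_open UNIV (flat n)"
proof -
  have "Ck_on k UNIV (flat n)" for k
  proof (induction k arbitrary: n)
    case 0
    then show ?case
      by (auto intro!: continuous_at_imp_continuous_on has_derivative_continuous flat_has_derivative)
  next
    case (Suc k)
    show ?case
      by (rule Ck_on_SucI[OF _ flat_has_derivative])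
        (intro Ck_on_bilinear[OF bounded_bilinear_mult] Ck_on_const Ck_on_add Suc open_UNIV)+
  qed
  then show ?thesis by (simp add: smooth_on_open_def)
qed

text \<open>The function is \<open>u / (u + w)\<close>, where \<open>u\<close> is positive exactly
  at distance less than \<open>r\<close> and \<open>w\<close> exactly at distance more than
  \<open>r/2\<close>; as \<open>r/2 < r\<close>, the denominator never vanishes. Squared distances
  keep the arguments smooth at the centre.\<close>

lemma smooth_cutoff:
  fixes z :: "'e::euclidean_space"
  assumes "0 < r"
  obtains \<beta> :: "'e \<Rightarrow> real" where "smooth_on_open UNIV \<beta>" "\<And>x. x \<in> ball z (r / 2) \<Longrightarrow> \<beta> x = 1"
    "\<And>x. x \<notin> ball z r \<Longrightarrow> \<beta> x = 0"
proof -
  have q: "smooth_on_open UNIV (\<lambda>x::'e. (x - z) \<bullet> (x - z))"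
    by (intro smooth_on_open_bilinear[OF bounded_bilinear_inner] smooth_on_open_diff
        smooth_on_open_linear bounded_linear_ident smooth_on_open_const open_UNIV)
  let ?u = "\<lambda>x::'e. flat 0 (r\<^sup>2 - (x - z) \<bullet> (x - z))"
  let ?w = "\<lambda>x::'e. flat 0 ((x - z) \<bullet> (x - z) - (r / 2)\<^sup>2)"
  have u: "smooth_on_open UNIV ?u" and w: "smooth_on_open UNIV ?w"
    by (rule smooth_on_open_compose[OF flat_smooth] smooth_on_open_diff q smooth_on_open_const open_UNIV UNIV_I)+
  have nn: "0 \<le> ?u x" "0 \<le> ?w x" for x by (simp_all add: flat_def)
  have r: "(r / 2)\<^sup>2 < r\<^sup>2" using assms by (simp add: power2_eq_square)
  have pos: "?u x + ?w x \<noteq> 0" for x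
  proof (cases "(x - z) \<bullet> (x - z) < r\<^sup>2")
    case True
    then have "0 < ?u x" by (simp add: flat_def)
    then show ?thesis using nn(2)[of x] by linarith
  next
    case False
    then have "0 < ?w x" using r by (simp add: flat_def)
    then show ?thesis using nn(1)[of x] by linarith
  qed
  have nz: "(x - z) \<bullet> (x - z) = (dist z x)\<^sup>2" for x
    by (simp add: dist_norm power2_norm_eq_inner[symmetric] norm_minus_commute)
  show ?thesis
  proof
    show "smooth_on_open UNIV (\<lambda>x. ?u x * inverse (?u x + ?w x))"
      by (intro smooth_on_open_bilinear[OF bounded_bilinear_mult] smooth_on_open_inverse
          smooth_on_open_add u w pos)
    show "?u x * inverse (?u x + ?w x) = 1" if "x \<in> ball z (r / 2)" for x
    proof -
      have "(dist z x)\<^sup>2 < (r / 2)\<^sup>2" using that by (intro power_strict_mono) auto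
      then have "?w x = 0" by (simp add: flat_def nz)
      then show ?thesis using pos[of x] by simp
    qed
    show "?u x * inverse (?u x + ?w x) = 0" if "x \<notin> ball z r" for x
    proof -
      have "r\<^sup>2 \<le> (dist z x)\<^sup>2" using that assms by (intro power_mono) auto
      then show ?thesis by (simp add: flat_def nz)
    qed
  qed
qed

section \<open>Hadamard's lemma\<close>

text \<open>Differentiating in \<open>x\<close> under the integral produces a factor
  \<open>t\<close> from \<open>z + t *\<^sub>R (x - z)\<close>; the weight \<open>t ^ j\<close>
  absorbs it, which makes the induction close. The segments from the centre stay inside the
  ball.\<close>

lemma Ck_on_segment_integral:
  fixes f :: "'e::euclidean_space \<Rightarrow> real"
  assumes "smooth_on_open (ball z r) f"
  shows "Ck_on k (ball z r) (\<lambda>x. integral (cbox 0 1) (\<lambda>t. t ^ j * f (z + t *\<^sub>R (x - z))))"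
  using assms
proof (induction k arbitrary: f j)
  have seg: "z + t *\<^sub>R (x - z) \<in> ball z r" if "x \<in> ball z r" "t \<in> cbox 0 1" for x t
  proof -
    have "norm (t *\<^sub>R (x - z)) \<le> norm (x - z)" using that(2)
      by (simp add: mult_left_le_one_le)
    then show ?thesis using that(1) by (simp add: dist_norm norm_minus_commute)
  qed
  have cont: "continuous_on (ball z r \<times> cbox 0 1) (\<lambda>(x, t). h (z + t *\<^sub>R (x - z)))"
    if "continuous_on (ball z r) h" for h :: "'e \<Rightarrow> 'c::real_normed_vector"
    unfolding split_beta by (rule continuous_on_compose2[OF that]) (auto intro!: continuous_intros seg simp: split_beta)
  {
    case 0
    have "continuous_on (ball z r \<times> cbox 0 1) (\<lambda>(x, t). t ^ j * f (z + t *\<^sub>R (x - z)))"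
      using cont[OF smooth_on_open_continuous[OF 0]] by (auto simp: split_beta intro!: continuous_intros)
    then show ?case unfolding Ck_on.simps(1) by (rule integral_continuous_on_param)
  next
    case (Suc k)
    note f = Suc.prems
    let ?B = "\<lambda>x. Blinfun (frechet_derivative f (at x))"
    have Bx: "blinfun_apply (?B x) = frechet_derivative f (at x)" if "x \<in> ball z r" for x
      using bounded_linear_Blinfun_apply[OF has_derivative_bounded_linear[OF smooth_on_open_has_derivative[OF f that]]] .
    let ?fx = "\<lambda>x t. t ^ Suc j *\<^sub>R ?B (z + t *\<^sub>R (x - z))"
    have cB: "continuous_on (ball z r \<times> cbox 0 1) (\<lambda>(x, t). ?fx x t)"
      using cont[OF smooth_on_open_continuous[OF smooth_on_open_Blinfun[OF f]]]
      by (auto simp: split_beta intro!: continuous_intros)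
    have cf: "continuous_on (cbox 0 1) (\<lambda>t. t ^ j * f (z + t *\<^sub>R (x - z)))" if "x \<in> ball z r" for x
      by (intro continuous_intros continuous_on_compose2[OF smooth_on_open_continuous[OF f]])
        (use seg that in auto)
    have cBx: "?fx x integrable_on cbox 0 1" if "x \<in> ball z r" for x
      by (intro integrable_continuous continuous_intros
          continuous_on_compose2[OF smooth_on_open_continuous[OF smooth_on_open_Blinfun[OF f]]])
        (use seg that in auto)
    show ?case
    proof (rule Ck_on_SucI)
      fix x assume x: "x \<in> ball z r"
      have "((\<lambda>x. integral (cbox 0 1) (\<lambda>t. t ^ j * f (z + t *\<^sub>R (x - z)))) has_derivative
          integral (cbox 0 1) (?fx x)) (at x within ball z r)"
      proof (rule leibniz_rule[OF _ _ cB x convex_ball])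
        fix x and t :: real assume x: "x \<in> ball z r" and t: "t \<in> cbox 0 1"
        have "((\<lambda>x. f (z + t *\<^sub>R (x - z))) has_derivative (\<lambda>v. frechet_derivative f (at (z + t *\<^sub>R (x - z))) (t *\<^sub>R v)))
            (at x within ball z r)"
          by (rule has_derivative_compose[where f = "\<lambda>x. z + t *\<^sub>R (x - z)",
              OF _ smooth_on_open_has_derivative[OF f seg[OF x t]]])
            (auto intro!: derivative_eq_intros)
        then show "((\<lambda>x. t ^ j * f (z + t *\<^sub>R (x - z))) has_derivative blinfun_apply (?fx x t)) (at x within ball z r)"
          using linear_scale[OF linear_frechet_derivative[OF differentiableI[OF smooth_on_open_has_derivative[OF f seg[OF x t]]]]]
          by (auto intro!: derivative_eq_intros simp: Bx[OF seg[OF x t]] blinfun.bilinear_simps fun_eq_iff mult_ac)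
      qed (rule integrable_continuous[OF cf])
      then show "((\<lambda>x. integral (cbox 0 1) (\<lambda>t. t ^ j * f (z + t *\<^sub>R (x - z)))) has_derivative
          integral (cbox 0 1) (?fx x)) (at x)"
        using x by (simp add: at_within_open[OF x open_ball])
    next
      fix v
      have "Ck_on k (ball z r) (\<lambda>x. integral (cbox 0 1) (\<lambda>t. t ^ Suc j *
          frechet_derivative f (at (z + t *\<^sub>R (x - z))) v))"
        by (rule Suc.IH[OF smooth_on_open_directional[OF f]])
      moreover have "integral (cbox 0 1) (\<lambda>t. t ^ Suc j * frechet_derivative f (at (z + t *\<^sub>R (x - z))) v)
          = blinfun_apply (integral (cbox 0 1) (?fx x)) v" if "x \<in> ball z r" for x
        unfolding blinfun_apply_integral[OF cBx[OF that]]
      proof (rule integral_cong)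
        fix t :: real assume "t \<in> cbox 0 1"
        then show "t ^ Suc j * frechet_derivative f (at (z + t *\<^sub>R (x - z))) v = blinfun_apply (?fx x t) v"
          by (simp only: Bx[OF seg[OF that]] blinfun.scaleR_left real_scaleR_def)
      qed
      ultimately show "Ck_on k (ball z r) (\<lambda>x. blinfun_apply (integral (cbox 0 1) (?fx x)) v)"
        by (rule Ck_on_cong[OF open_ball, rotated])
    qed auto
  }
qed

text \<open>By the fundamental theorem of calculus along the segment from \<open>z\<close> to
  \<open>x\<close>, the coefficient \<open>G b\<close> is the mean of a directional derivative along
  that segment; at \<open>x = z\<close> it is the mean of a constant.\<close>

lemma Hadamard_lemma:
  fixes f :: "'e::euclidean_space \<Rightarrow> real"
  assumes f: "smooth_on_open (ball z r) f"
  obtains G where "\<And>b. smooth_on_open (ball z r) (G b)"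
    "\<And>x. x \<in> ball z r \<Longrightarrow> f x = f z + (\<Sum>b\<in>Basis. ((x - z) \<bullet> b) * G b x)"
    "\<And>b. 0 < r \<Longrightarrow> G b z = frechet_derivative f (at z) b"
proof
  let ?G = "\<lambda>b x. integral (cbox 0 1) (\<lambda>t. frechet_derivative f (at (z + t *\<^sub>R (x - z))) b)"
  show "smooth_on_open (ball z r) (?G b)" for b
    using Ck_on_segment_integral[OF smooth_on_open_directional[OF f, of b], of _ 0]
    by (simp add: smooth_on_open_def)
  show "?G b z = frechet_derivative f (at z) b" for b by simp
  fix x assume x: "x \<in> ball z r"
  have seg: "z + t *\<^sub>R (x - z) \<in> ball z r" if "t \<in> {0..1}" for t
  proof -
    have "norm (t *\<^sub>R (x - z)) \<le> norm (x - z)" using that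
      by (simp add: mult_left_le_one_le)
    then show ?thesis using x by (simp add: dist_norm norm_minus_commute)
  qed
  let ?D = "\<lambda>t. frechet_derivative f (at (z + t *\<^sub>R (x - z)))"
  have "((\<lambda>t. f (z + t *\<^sub>R (x - z))) has_vector_derivative ?D t (x - z)) (at t within {0..1})"
    if t: "t \<in> {0..1}" for t
  proof -
    have "((\<lambda>t. f (z + t *\<^sub>R (x - z))) has_derivative (\<lambda>v. ?D t (v *\<^sub>R (x - z)))) (at t within {0..1})"
      by (rule has_derivative_compose[where f = "\<lambda>t. z + t *\<^sub>R (x - z)",
            OF _ smooth_on_open_has_derivative[OF f seg[OF t]]])
        (auto intro!: derivative_eq_intros)
    then show ?thesis
      using linear_scale[OF linear_frechet_derivative[OF differentiableI[OF smooth_on_open_has_derivative[OF f seg[OF t]]]]]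
      by (simp add: has_vector_derivative_def)
  qed
  from fundamental_theorem_of_calculus[OF _ this]
  have "((\<lambda>t. ?D t (x - z)) has_integral f x - f z) {0..1}" by simp
  then have 1: "f x - f z = integral {0..1} (\<lambda>t. ?D t (x - z))" by (simp add: integral_unique)
  have "?D t (x - z) = (\<Sum>b\<in>Basis. ((x - z) \<bullet> b) * ?D t b)" if t: "t \<in> {0..1}" for t
  proof -
    have l: "linear (?D t)"
      by (rule linear_frechet_derivative[OF differentiableI[OF smooth_on_open_has_derivative[OF f seg[OF t]]]])
    have "?D t (\<Sum>b\<in>Basis. ((x - z) \<bullet> b) *\<^sub>R b) = (\<Sum>b\<in>Basis. ((x - z) \<bullet> b) * ?D t b)"
      by (simp only: linear_sum[OF l] linear_scale[OF l] real_scaleR_def)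
    then show ?thesis by (simp only: euclidean_representation)
  qed
  then have "integral {0..1} (\<lambda>t. ?D t (x - z)) = integral {0..1} (\<lambda>t. \<Sum>b\<in>Basis. ((x - z) \<bullet> b) * ?D t b)"
    by (rule integral_cong)
  also have "\<dots> = (\<Sum>b\<in>Basis. integral {0..1} (\<lambda>t. ((x - z) \<bullet> b) * ?D t b))"
  proof (rule integral_sum)
    fix b :: 'e
    have "continuous_on {0..1} (\<lambda>t. ?D t b)"
      by (rule continuous_on_compose2[OF smooth_on_open_continuous[OF smooth_on_open_directional[OF f, of b]]])
        (use seg in \<open>auto intro!: continuous_intros\<close>)
    then show "(\<lambda>t. ((x - z) \<bullet> b) * ?D t b) integrable_on {0..1}"
      by (intro integrable_continuous_interval continuous_intros)
  qed simp
  finally show "f x = f z + (\<Sum>b\<in>Basis. ((x - z) \<bullet> b) * ?G b x)"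
    using 1 by simp
qed

lemma smooth_on_iff:
  "smooth_on A f \<longleftrightarrow> (\<forall>x\<in>A. \<exists>U F. x \<in> U \<and> smooth_on_open U F \<and> (\<forall>y\<in>A \<inter> U. F y = f y))"
  unfolding smooth_on_def smooth_on_open_def by blast

lemma smooth_on_open_preimage:
  assumes "smooth_on_open S f" "open T"
  shows "open {x \<in> S. f x \<in> T}"
proof -
  have "open (S \<inter> f -` T)"
    using assms smooth_on_open_continuous[OF assms(1)]
    by (intro continuous_open_preimage) (auto simp: smooth_on_open_def)
  then show ?thesis by (simp add: vimage_def Collect_conj_eq)
qed

subsection \<open>Linear algebra on subspaces\<close>

text \<open>Coordinates live in a model subspace while derivatives are taken in the whole space;
  \<open>P\<close> leads from the latter to the former. The last property says that
  \<open>x - P x\<close> is orthogonal to \<open>S\<close>.\<close>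

lemma orthogonal_projection_exists:
  fixes S :: "'e::euclidean_space set"
  assumes "subspace S"
  obtains P where "linear P" "\<And>x. P x \<in> S" "\<And>x. x \<in> S \<Longrightarrow> P x = x" "\<And>x y. y \<in> S \<Longrightarrow> P x \<bullet> y = x \<bullet> y"
proof -
  obtain C where C: "C \<subseteq> S" "pairwise orthogonal C" "\<And>x. x \<in> C \<Longrightarrow> norm x = 1"
    "independent C" "span C = S"
    using orthonormal_basis_subspace[OF assms] by metis
  have fin: "finite C" using C(4) independent_imp_finite by blast
  let ?P = "\<lambda>x. \<Sum>c\<in>C. (x \<bullet> c) *\<^sub>R c"
  have fixC: "?P c = c" if "c \<in> C" for c
  proof -
    have "?P c = (\<Sum>d\<in>C. if d = c then c else 0)"
    proof (rule sum.cong)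
      fix d assume d: "d \<in> C"
      show "(c \<bullet> d) *\<^sub>R d = (if d = c then c else 0)"
      proof (cases "d = c")
        case True
        then show ?thesis using C(3)[OF that] by (simp add: norm_eq_1)
      next
        case False
        then have "c \<bullet> d = 0" using C(2) that d by (auto simp: pairwise_def orthogonal_def)
        then show ?thesis using False by simp
      qed
    qed simp
    then show ?thesis using fin that by simp
  qed
  have lin: "linear ?P"
    by (rule linearI) (simp_all add: inner_add_left scaleR_add_left sum.distrib scaleR_sum_right)
  have fixS: "?P x = x" if "x \<in> S" for x
    using that unfolding C(5)[symmetric]
  proof (induction x rule: span_induct_alt)
    case base
    then show ?case by simp
  next
    case (step a c x)
    then show ?case using linear_add[OF lin] linear_scale[OF lin] fixC by simp
  qed
  have adj: "?P x \<bullet> y = x \<bullet> ?P y" for x y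
    by (simp add: inner_sum_left inner_sum_right mult.commute inner_commute)
  show ?thesis
  proof
    show "?P x \<in> S" for x
      using C(1) assms by (intro subspace_sum subspace_scale) auto
    show "?P x \<bullet> y = x \<bullet> y" if "y \<in> S" for x y
      using adj[of x y] fixS[OF that] by simp
  qed (fact lin fixS)+
qed

text \<open>\<open>B\<close> and \<open>l\<close> are controlled on \<open>S\<close> only, so they
  are precomposed with a projection \<open>P\<close> onto \<open>S\<close>. The form then becomes an
  endomorphism \<open>T\<close> of the whole Euclidean space, and the representing vector exists
  because an injective endomorphism is surjective.\<close>

lemma nondegenerate_form_represents:
  fixes S :: "'e::euclidean_space set" and B :: "'e \<Rightarrow> 'e \<Rightarrow> real"
  assumes S: "subspace S"
    and B: "\<And>x y z a b. x \<in> S \<Longrightarrow> y \<in> S \<Longrightarrow> z \<in> S \<Longrightarrow> B (a *\<^sub>R x + b *\<^sub>R y) z = a * B x z + b * B y z"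
    and sym: "\<And>x y. x \<in> S \<Longrightarrow> y \<in> S \<Longrightarrow> B x y = B y x"
    and nondeg: "\<And>x. x \<in> S \<Longrightarrow> (\<And>y. y \<in> S \<Longrightarrow> B x y = 0) \<Longrightarrow> x = 0"
    and l: "\<And>x y a b. x \<in> S \<Longrightarrow> y \<in> S \<Longrightarrow> l (a *\<^sub>R x + b *\<^sub>R y) = a * l x + b * l y"
  obtains x where "x \<in> S" "\<And>y. y \<in> S \<Longrightarrow> B x y = l y"
proof -
  obtain P where P: "linear P" "\<And>x. P x \<in> S" "\<And>x. x \<in> S \<Longrightarrow> P x = x"
      "\<And>x y. y \<in> S \<Longrightarrow> P x \<bullet> y = x \<bullet> y"
    using orthogonal_projection_exists[OF S] by metis
  have rep: "(\<Sum>b\<in>Basis. f b *\<^sub>R b) \<bullet> y = f y" if "linear f" for f :: "'e \<Rightarrow> real" and y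
  proof -
    have "f y = f (\<Sum>b\<in>Basis. (y \<bullet> b) *\<^sub>R b)" by (simp only: euclidean_representation)
    also have "\<dots> = (\<Sum>b\<in>Basis. (y \<bullet> b) * f b)"
      by (simp only: linear_sum[OF that] linear_scale[OF that] real_scaleR_def)
    finally show ?thesis by (simp add: inner_sum_left inner_sum_right inner_commute mult.commute)
  qed
  have linl: "linear (\<lambda>y. l (P y))"
    using l[OF P(2) P(2), of 1 _ 1] l[OF P(2) P(2), of _ _ 0]
    by (intro linearI) (simp_all add: linear_add[OF P(1)] linear_scale[OF P(1)])
  have lin1: "linear (\<lambda>x. B (P x) z)" if "z \<in> S" for z
    using B[OF P(2) P(2) that, of 1 _ 1] B[OF P(2) P(2) that, of _ _ 0]
    by (intro linearI) (simp_all add: linear_add[OF P(1)] linear_scale[OF P(1)])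
  have lin2: "linear (\<lambda>y. B (P x) (P y))" for x
    using lin1[OF P(2)[of x]] by (simp add: sym[OF P(2) P(2)])
  \<comment> \<open>The first summand represents the form; the second is the identity on the
    orthogonal complement of \<open>S\<close> and makes \<open>T\<close> injective there as
    well.\<close>
  define T where "T x = (\<Sum>b\<in>Basis. B (P x) (P b) *\<^sub>R b) + (x - P x)" for x
  have T: "T x \<bullet> y = B (P x) y" if "y \<in> S" for x y
    using rep[OF lin2, of x y] P(3,4)[OF that] by (simp add: T_def inner_add_left inner_diff_left)
  have "linear T"
    unfolding T_def
  proof (intro linear_compose_add linear_compose_sub linear_ident P(1) linear_compose_sum ballI)
    show "linear (\<lambda>x. B (P x) (P b) *\<^sub>R b)" for b
      using linear_compose[OF lin1[OF P(2)[of b]], of "\<lambda>r. r *\<^sub>R b"]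
      by (simp add: o_def linear_scaleR_left)
  qed
  moreover have "x = 0" if "T x = 0" for x
  proof -
    have "P x = 0" using nondeg[OF P(2)] T that by (metis inner_zero_left)
    moreover have "B (P x) (P b) = 0" for b using T[OF P(2), of x b] that by simp
    ultimately show ?thesis using that by (simp add: T_def)
  qed
  ultimately have "surj T"
    by (simp add: linear_injective_imp_surjective linear_injective_0)
  then obtain x where x: "T x = (\<Sum>b\<in>Basis. l (P b) *\<^sub>R b)" by (metis surjD)
  show ?thesis
  proof
    show "P x \<in> S" by (rule P(2))
    show "B (P x) y = l y" if "y \<in> S" for y
      using T[OF that, of x] rep[OF linl, of y] P(3)[OF that] by (simp add: x)
  qed
qed

subsection \<open>Smooth functions and derivations on a manifold\<close>

text \<open>The model space, existentially quantified in \<open>smooth_manifold\<close>, becomes the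
  parameter \<open>E\<close>, so that all charts refer to one fixed subspace.\<close>

locale smooth_mfd =
  fixes M :: "('a, 'e::euclidean_space) manifold" and E :: "'e set"
  assumes hausdorff: "Hausdorff_space (mtop M)"
    and subspace_E: "subspace E"
    and chart: "\<And>U h. (U, h) \<in> atlas M \<Longrightarrow> openin (mtop M) U \<and> openin (top_of_set E) (h ` U) \<and>
           homeomorphic_map (subtopology (mtop M) U) (top_of_set (h ` U)) h"
    and atlas_covers: "(\<Union>(U, h)\<in>atlas M. U) = points M"
    and compatible: "\<And>U h V k. (U, h) \<in> atlas M \<Longrightarrow> (V, k) \<in> atlas M \<Longrightarrow>
          smooth_on (h ` (U \<inter> V)) (k \<circ> inv_into U h)"

lemma smooth_manifold_imp_smooth_mfd:
  assumes "smooth_manifold n M" obtains E where "smooth_mfd M E"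
  using assms unfolding smooth_manifold_def smooth_mfd_def by fast

context smooth_mfd
begin

lemma chart_at: assumes "p \<in> points M" obtains U h where "(U, h) \<in> atlas M" "p \<in> U"
  using assms atlas_covers by blast

lemma chart_subset: "(U, h) \<in> atlas M \<Longrightarrow> U \<subseteq> points M"
  using chart openin_subset by blast

lemma chart_inj: "(U, h) \<in> atlas M \<Longrightarrow> inj_on h U"
  using homeomorphic_imp_injective_map[of "subtopology (mtop M) U"] chart[of U h] chart_subset[of U h]
  by (metis topspace_subtopology_subset)

lemma chart_inv [simp]: "(U, h) \<in> atlas M \<Longrightarrow> q \<in> U \<Longrightarrow> inv_into U h (h q) = q"
  by (simp add: chart_inj)

lemma chart_in_E: "(U, h) \<in> atlas M \<Longrightarrow> q \<in> U \<Longrightarrow> h q \<in> E"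
  using chart[of U h] openin_imp_subset by fastforce

lemma chart_image_open:
  assumes "(U, h) \<in> atlas M" "openin (mtop M) W" "W \<subseteq> U"
  obtains G where "open G" "h ` W = E \<inter> G"
proof -
  have "openin (subtopology (mtop M) U) W"
    using assms(2,3) by (simp add: openin_subset_topspace_eq openin_subtopology_Int2 subset_openin_subtopology)
  then have "openin (top_of_set (h ` U)) (h ` W)"
    using chart[OF assms(1)] homeomorphic_imp_open_map[unfolded open_map_def] by blast
  then have "openin (top_of_set E) (h ` W)"
    using chart[OF assms(1)] openin_trans by blast
  then show ?thesis using that by (auto simp: openin_open)
qed

text \<open>Turns an open condition on the manifold into one on coordinates: shrinking the domain of
  a representative to \<open>G\<close> forces its chart points into \<open>W\<close>, because the
  chart is injective.\<close>

lemma chart_imageD: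
  assumes "(U, h) \<in> atlas M" "W \<subseteq> U" "h ` W = E \<inter> G" "q \<in> U" "h q \<in> G"
  shows "q \<in> W"
proof -
  have "h q \<in> h ` W" using assms(3,5) chart_in_E[OF assms(1,4)] by blast
  then show ?thesis using chart_inj[OF assms(1)] assms(2,4) by (auto simp: inj_on_def)
qed

lemma chart_preimage_open:
  assumes "(U, h) \<in> atlas M" "open G"
  shows "openin (mtop M) {q \<in> U. h q \<in> G}"
proof -
  have "continuous_map (subtopology (mtop M) U) (top_of_set (h ` U)) h"
    using chart[OF assms(1)] homeomorphic_imp_continuous_map by blast
  then have "openin (subtopology (mtop M) U) {q \<in> topspace (subtopology (mtop M) U). h q \<in> h ` U \<inter> G}"
    using assms(2) by (intro openin_continuous_map_preimage) auto
  moreover have "{q \<in> topspace (subtopology (mtop M) U). h q \<in> h ` U \<inter> G} = {q \<in> U. h q \<in> G}"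
    using chart_subset[OF assms(1)] by auto
  ultimately show ?thesis
    using chart[OF assms(1)] by (metis openin_trans_full)
qed

section \<open>Smooth functions on a manifold: gluing and cutoffs\<close>

text \<open>One chart around \<open>p\<close> is enough here, in contrast with
  \<open>smooth_funs\<close>, which quantifies over all charts. The transition maps bridge the
  difference in \<open>smooth_funsI\<close>.\<close>

definition smooth_at :: "('a \<Rightarrow> real) \<Rightarrow> 'a \<Rightarrow> bool" where
  "smooth_at f p \<longleftrightarrow> (\<exists>U h G F. (U, h) \<in> atlas M \<and> p \<in> U \<and> h p \<in> G \<and>
     smooth_on_open G F \<and> (\<forall>q\<in>U. h q \<in> G \<longrightarrow> f q = F (h q)))"

lemma smooth_atI:
  "(U, h) \<in> atlas M \<Longrightarrow> p \<in> U \<Longrightarrow> h p \<in> G \<Longrightarrow> smooth_on_open G F \<Longrightarrow>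
    (\<And>q. q \<in> U \<Longrightarrow> h q \<in> G \<Longrightarrow> f q = F (h q)) \<Longrightarrow> smooth_at f p"
  unfolding smooth_at_def by blast

lemma smooth_funsI:
  assumes "\<And>p. p \<in> points M \<Longrightarrow> smooth_at f p"
  shows "f \<in> smooth_funs M"
proof -
  have "\<exists>W F. y \<in> W \<and> smooth_on_open W F \<and> (\<forall>y'\<in>k ` V \<inter> W. F y' = (f \<circ> inv_into V k) y')"
    if V: "(V, k) \<in> atlas M" and y: "y \<in> k ` V" for V k y
  proof -
    obtain p where p: "p \<in> V" "y = k p" using y by blast
    obtain U h G F where U: "(U, h) \<in> atlas M" "p \<in> U" "h p \<in> G" and F: "smooth_on_open G F"
      and fF: "\<And>q. q \<in> U \<Longrightarrow> h q \<in> G \<Longrightarrow> f q = F (h q)"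
      using assms[of p] chart_subset[OF V] p unfolding smooth_at_def by blast
    obtain G2 T where T: "y \<in> G2" "smooth_on_open G2 T"
      "\<And>y'. y' \<in> k ` (V \<inter> U) \<Longrightarrow> y' \<in> G2 \<Longrightarrow> T y' = h (inv_into V k y')"
    proof -
      have "y \<in> k ` (V \<inter> U)" using p U(2) by blast
      then obtain G2 T where T: "y \<in> G2" "smooth_on_open G2 T"
        "\<forall>y'\<in>k ` (V \<inter> U) \<inter> G2. T y' = (h \<circ> inv_into V k) y'"
        using compatible[OF V U(1)] unfolding smooth_on_iff by blast
      show ?thesis by (rule that[OF T(1,2)]) (use T(3) in auto)
    qed
    obtain O' where O': "open O'" "k ` (V \<inter> U) = E \<inter> O'"
      using chart_image_open[OF V, of "V \<inter> U"] chart V U(1) by blast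
    \<comment> \<open>\<open>O'\<close> guarantees that points of \<open>V\<close> with coordinates
      in \<open>?W\<close> lie in the overlap, where \<open>T\<close> really is the transition map;
      the second set keeps \<open>T x\<close> in the domain of \<open>F\<close>.\<close>
    let ?W = "O' \<inter> {x \<in> G2. T x \<in> G}"
    have W: "open ?W"
      using O'(1) smooth_on_open_preimage[OF T(2)] F by (auto simp: smooth_on_open_def)
    show ?thesis
    proof (intro exI conjI ballI)
      have "y \<in> k ` (V \<inter> U)" using p U(2) by blast
      then show "y \<in> ?W" using T(1,3) O'(2) U(3) p V by auto
      show "smooth_on_open ?W (\<lambda>x. F (T x))"
        by (rule smooth_on_open_compose[OF F smooth_on_open_subset[OF T(2) W]]) auto
      fix y' assume y': "y' \<in> k ` V \<inter> ?W"
      then obtain q where q: "q \<in> V" "y' = k q" by blast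
      have "q \<in> V \<inter> U" using chart_imageD[OF V _ O'(2) q(1)] y' q(2) by simp
      then show "F (T y') = (f \<circ> inv_into V k) y'"
        using T(3)[of y'] y' q V fF[of q] by auto
    qed
  qed
  then show ?thesis by (auto simp: smooth_funs_def smooth_on_iff)
qed

lemma smooth_funsE:
  assumes "f \<in> smooth_funs M" "(U, h) \<in> atlas M" "p \<in> U"
  obtains G F where "h p \<in> G" "smooth_on_open G F" "\<And>q. q \<in> U \<Longrightarrow> h q \<in> G \<Longrightarrow> f q = F (h q)"
proof -
  have "smooth_on (h ` U) (f \<circ> inv_into U h)" using assms(1,2) by (auto simp: smooth_funs_def)
  then obtain G F where "h p \<in> G" "smooth_on_open G F" "\<forall>y\<in>h ` U \<inter> G. F y = (f \<circ> inv_into U h) y"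
    unfolding smooth_on_iff using assms(3) by blast
  then show ?thesis using that[of G F] assms(2) by auto
qed

lemma smooth_at_cong:
  assumes W: "openin (mtop M) W" "p \<in> W" "\<And>q. q \<in> W \<Longrightarrow> f q = g q" and f: "smooth_at f p"
  shows "smooth_at g p"
proof -
  obtain U h G F where U: "(U, h) \<in> atlas M" "p \<in> U" "h p \<in> G" and F: "smooth_on_open G F"
    and fF: "\<And>q. q \<in> U \<Longrightarrow> h q \<in> G \<Longrightarrow> f q = F (h q)"
    using f unfolding smooth_at_def by blast
  obtain O' where O': "open O'" "h ` (U \<inter> W) = E \<inter> O'"
    using chart_image_open[OF U(1), of "U \<inter> W"] chart U(1) W(1) by blast
  show ?thesis
  proof (rule smooth_atI[OF U(1,2)])
    show "h p \<in> G \<inter> O'" using U W(2) O'(2) by blast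
    show "smooth_on_open (G \<inter> O') F"
      using smooth_on_open_subset[OF F, of "G \<inter> O'"] F O'(1) by (simp add: smooth_on_open_def open_Int)
    show "g q = F (h q)" if "q \<in> U" "h q \<in> G \<inter> O'" for q
    proof -
      have "q \<in> U \<inter> W" using chart_imageD[OF U(1) _ O'(2) that(1)] that(2) by simp
      then show ?thesis using W(3)[of q] fF[of q] that(2) by simp
    qed
  qed
qed

lemma smooth_at_const: "p \<in> points M \<Longrightarrow> smooth_at (\<lambda>x. c) p"
  using chart_at[of p] smooth_atI[of _ _ p UNIV "\<lambda>x. c"] smooth_on_open_const by (metis UNIV_I open_UNIV)

lemma smooth_funs_const: "(\<lambda>x. c) \<in> smooth_funs M"
  by (intro smooth_funsI smooth_at_const)

lemma smooth_funs_binop: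
  assumes f: "f \<in> smooth_funs M" and g: "g \<in> smooth_funs M"
    and op: "\<And>G F F'. smooth_on_open G F \<Longrightarrow> smooth_on_open G F' \<Longrightarrow> smooth_on_open G (\<lambda>y::'e. op (F y) (F' y))"
  shows "(\<lambda>x. op (f x) (g x)) \<in> smooth_funs M"
proof (rule smooth_funsI)
  fix p assume "p \<in> points M"
  then obtain U h where U: "(U, h) \<in> atlas M" "p \<in> U" using chart_at by blast
  obtain G F where F: "h p \<in> G" "smooth_on_open G F" "\<And>q. q \<in> U \<Longrightarrow> h q \<in> G \<Longrightarrow> f q = F (h q)"
    using smooth_funsE[OF f U] by blast
  obtain G' F' where F': "h p \<in> G'" "smooth_on_open G' F'" "\<And>q. q \<in> U \<Longrightarrow> h q \<in> G' \<Longrightarrow> g q = F' (h q)"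
    using smooth_funsE[OF g U] by blast
  show "smooth_at (\<lambda>x. op (f x) (g x)) p"
  proof (rule smooth_atI[OF U])
    have "open (G \<inter> G')" using F(2) F'(2) by (auto simp: smooth_on_open_def)
    then show "smooth_on_open (G \<inter> G') (\<lambda>y. op (F y) (F' y))"
      by (intro op smooth_on_open_subset[OF F(2)] smooth_on_open_subset[OF F'(2)]) auto
  qed (use F F' in auto)
qed

lemma smooth_funs_add: "f \<in> smooth_funs M \<Longrightarrow> g \<in> smooth_funs M \<Longrightarrow> (\<lambda>x. f x + g x) \<in> smooth_funs M"
  by (rule smooth_funs_binop) (auto intro: smooth_on_open_add)

lemma smooth_funs_diff: "f \<in> smooth_funs M \<Longrightarrow> g \<in> smooth_funs M \<Longrightarrow> (\<lambda>x. f x - g x) \<in> smooth_funs M"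
  by (rule smooth_funs_binop) (auto intro: smooth_on_open_diff)

lemma smooth_funs_mult: "f \<in> smooth_funs M \<Longrightarrow> g \<in> smooth_funs M \<Longrightarrow> (\<lambda>x. f x * g x) \<in> smooth_funs M"
  by (rule smooth_funs_binop) (auto intro: smooth_on_open_bilinear[OF bounded_bilinear_mult])

lemma smooth_funs_sum:
  "(\<And>i. i \<in> I \<Longrightarrow> f i \<in> smooth_funs M) \<Longrightarrow> (\<lambda>x. \<Sum>i\<in>I. f i x) \<in> smooth_funs M"
  by (induction I rule: infinite_finite_induct) (auto intro: smooth_funs_add smooth_funs_const)

text \<open>\<open>smooth_at\<close> is a condition on a neighbourhood, so the boundary of
  \<open>K\<close> is covered by the second assumption; the complement of \<open>K\<close> is open,
  and \<open>f\<close> is zero there.\<close>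

lemma smooth_funs_glue:
  assumes "closedin (mtop M) K" "\<And>q. q \<in> K \<Longrightarrow> smooth_at f q" "\<And>q. q \<notin> K \<Longrightarrow> f q = 0"
  shows "f \<in> smooth_funs M"
proof (rule smooth_funsI)
  fix p assume p: "p \<in> points M"
  show "smooth_at f p"
  proof (cases "p \<in> K")
    case False
    show ?thesis
      by (rule smooth_at_cong[of "points M - K", OF _ _ _ smooth_at_const[OF p, of 0]])
        (use assms(1,3) p False in auto)
  qed (use assms(2) in auto)
qed

text \<open>The Hausdorff property enters here: \<open>K\<close> is a closed coordinate ball,
  compact as the continuous image of a compact subset of \<open>E\<close>, hence closed in the whole
  manifold and not merely in the chart. This closedness makes extension by zero smooth.\<close>

lemma cutoff_exists:
  assumes U: "(U, h) \<in> atlas M" "p \<in> U" and W: "openin (mtop M) W" "p \<in> W"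
  obtains \<beta> K W' where "\<beta> \<in> smooth_funs M" "closedin (mtop M) K" "K \<subseteq> W" "K \<subseteq> U"
    "\<And>q. q \<notin> K \<Longrightarrow> \<beta> q = 0" "openin (mtop M) W'" "p \<in> W'" "W' \<subseteq> K" "\<And>q. q \<in> W' \<Longrightarrow> \<beta> q = (1::real)"
proof -
  obtain O' where O': "open O'" "h ` (U \<inter> W) = E \<inter> O'"
    using chart_image_open[OF U(1), of "U \<inter> W"] chart U(1) W(1) by blast
  have "h p \<in> O'" using O'(2) U W by blast
  then obtain r where r: "0 < r" "cball (h p) r \<subseteq> O'" using O'(1) open_contains_cball by blast
  let ?K = "{q \<in> U. h q \<in> cball (h p) r}"
  obtain b where b: "smooth_on_open UNIV b" "\<And>x. x \<in> ball (h p) (r / 2) \<Longrightarrow> b x = (1::real)"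
    "\<And>x. x \<notin> ball (h p) r \<Longrightarrow> b x = 0" using smooth_cutoff[OF r(1)] by metis
  have KW: "?K \<subseteq> U \<inter> W" using chart_imageD[OF U(1) Int_lower1 O'(2)] r(2) by blast
  have img: "E \<inter> cball (h p) r \<subseteq> h ` U" using O'(2) r(2) by blast
  have Keq: "?K = inv_into U h ` (E \<inter> cball (h p) r)"
  proof (intro equalityI subsetI)
    fix q assume q: "q \<in> ?K"
    then have "q = inv_into U h (h q)" using U(1) by simp
    then show "q \<in> inv_into U h ` (E \<inter> cball (h p) r)" using q chart_in_E[OF U(1)] by blast
  next
    fix q assume "q \<in> inv_into U h ` (E \<inter> cball (h p) r)"
    then obtain y where y: "y \<in> E \<inter> cball (h p) r" "q = inv_into U h y" by blast
    then show "q \<in> ?K" using img inv_into_into[of y h U] f_inv_into_f[of y h U] by auto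
  qed
  have cont: "continuous_map (top_of_set (h ` U)) (subtopology (mtop M) U) (inv_into U h)"
  proof -
    obtain g where g: "homeomorphic_maps (subtopology (mtop M) U) (top_of_set (h ` U)) h g"
      using chart[OF U(1)] homeomorphic_map_maps by blast
    have "continuous_map (top_of_set (h ` U)) (subtopology (mtop M) U) g"
      using g by (simp add: homeomorphic_maps_def)
    moreover have "g y = inv_into U h y" if "y \<in> topspace (top_of_set (h ` U))" for y
      using that g U(1) chart_subset[OF U(1)] by (auto simp: homeomorphic_maps_def)
    ultimately show ?thesis using continuous_map_eq by blast
  qed
  have "compact (E \<inter> cball (h p) r)"
    using closed_subspace[OF subspace_E] by (simp add: closed_Int_compact)
  then have "compactin (top_of_set (h ` U)) (E \<inter> cball (h p) r)"
    using img by (simp add: compactin_subtopology)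
  then have "compactin (subtopology (mtop M) U) ?K"
    unfolding Keq by (rule image_compactin[OF _ cont])
  then have K: "closedin (mtop M) ?K"
    by (simp add: compactin_subtopology compactin_imp_closedin[OF hausdorff])
  show ?thesis
  proof
    show "(\<lambda>q. if q \<in> U then b (h q) else 0) \<in> smooth_funs M"
    proof (rule smooth_funs_glue[OF K])
      show "smooth_at (\<lambda>q. if q \<in> U then b (h q) else 0) q" if "q \<in> ?K" for q
        by (rule smooth_atI[OF U(1) _ UNIV_I b(1)]) (use that in auto)
    qed (use b(3) in auto)
    show "openin (mtop M) {q \<in> U. h q \<in> ball (h p) (r / 2)}"
      by (rule chart_preimage_open[OF U(1) open_ball])
    show "p \<in> {q \<in> U. h q \<in> ball (h p) (r / 2)}" using U r(1) by simp
    show "{q \<in> U. h q \<in> ball (h p) (r / 2)} \<subseteq> ?K" using r(1) by auto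
  qed (use K KW b(2,3) in auto)
qed

text \<open>\<open>F\<close> and \<open>h\<close> have arbitrary values outside their domains. The
  factor \<open>\<beta>\<close> vanishes off \<open>K\<close>, and on \<open>K\<close> both are
  under control, so the junk values are multiplied by zero.\<close>

lemma cutoff_extension:
  assumes U: "(U, h) \<in> atlas M" and \<beta>: "\<beta> \<in> smooth_funs M" "\<And>q. q \<notin> K \<Longrightarrow> \<beta> q = 0"
    and K: "closedin (mtop M) K" "K \<subseteq> {q \<in> U. h q \<in> G}" and F: "smooth_on_open G F"
  shows "(\<lambda>q. \<beta> q * F (h q)) \<in> smooth_funs M"
proof (rule smooth_funs_glue[OF K(1)])
  fix q assume q: "q \<in> K"
  then have qU: "q \<in> U" "h q \<in> G" using K by auto
  obtain G' B where B: "h q \<in> G'" "smooth_on_open G' B" "\<And>x. x \<in> U \<Longrightarrow> h x \<in> G' \<Longrightarrow> \<beta> x = B (h x)"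
    using smooth_funsE[OF \<beta>(1) U qU(1)] by blast
  show "smooth_at (\<lambda>q. \<beta> q * F (h q)) q"
  proof (rule smooth_atI[OF U qU(1)])
    have "open (G \<inter> G')" using F B(2) by (auto simp: smooth_on_open_def)
    then show "smooth_on_open (G \<inter> G') (\<lambda>y. B y * F y)"
      by (intro smooth_on_open_bilinear[OF bounded_bilinear_mult] smooth_on_open_subset[OF F]
          smooth_on_open_subset[OF B(2)]) auto
  qed (use qU B in auto)
qed (use \<beta> in auto)

text \<open>Derivations act on global smooth functions, whereas chart coordinates are local. The
  functions \<open>c b\<close> are cut-off coordinates.\<close>

lemma coordinate_functions_exist:
  assumes U: "(U, h) \<in> atlas M" "p \<in> U"
  obtains c W where "\<And>b. c b \<in> smooth_funs M" "openin (mtop M) W" "p \<in> W" "W \<subseteq> U"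
    "\<And>b q. q \<in> W \<Longrightarrow> c b q = h q \<bullet> b"
proof -
  obtain \<beta> K W' where *: "\<beta> \<in> smooth_funs M" "closedin (mtop M) K" "K \<subseteq> U" "K \<subseteq> U"
    "\<And>q. q \<notin> K \<Longrightarrow> \<beta> q = 0" "openin (mtop M) W'" "p \<in> W'" "W' \<subseteq> K" "\<And>q. q \<in> W' \<Longrightarrow> \<beta> q = (1::real)"
    by (rule cutoff_exists[OF U, of U]) (use chart U in auto)
  show ?thesis
  proof
    show "(\<lambda>q. \<beta> q * (h q \<bullet> b)) \<in> smooth_funs M" for b
      by (rule cutoff_extension[OF U(1) *(1,5,2), of UNIV "\<lambda>y. y \<bullet> b"])
        (use * in \<open>auto intro: smooth_on_open_linear bounded_linear_inner_left\<close>)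
    show "openin (mtop M) W'" "p \<in> W'" "W' \<subseteq> U" using * by auto
    show "\<beta> q * (h q \<bullet> b) = h q \<bullet> b" if "q \<in> W'" for b q using *(9)[OF that] by simp
  qed
qed

section \<open>Derivations and their coordinates\<close>

lemma tangent_lincomb:
  "v \<in> tangent_space M p \<Longrightarrow> f \<in> smooth_funs M \<Longrightarrow> g \<in> smooth_funs M \<Longrightarrow>
    v (\<lambda>x. a * f x + b * g x) = a * v f + b * v g"
  by (auto simp: tangent_space_def)

lemma tangent_mult:
  "v \<in> tangent_space M p \<Longrightarrow> f \<in> smooth_funs M \<Longrightarrow> g \<in> smooth_funs M \<Longrightarrow>
    v (\<lambda>x. f x * g x) = f p * v g + g p * v f"
  by (auto simp: tangent_space_def)

lemma tangent_nonsmooth: "v \<in> tangent_space M p \<Longrightarrow> f \<notin> smooth_funs M \<Longrightarrow> v f = 0"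
  by (auto simp: tangent_space_def)

lemma tangent_const: assumes "v \<in> tangent_space M p" shows "v (\<lambda>x. c) = 0"
proof -
  have "v (\<lambda>x. 1) = 0"
    using tangent_mult[OF assms smooth_funs_const smooth_funs_const, of 1 1] by simp
  then show ?thesis using tangent_lincomb[OF assms smooth_funs_const smooth_funs_const, of c 1 0 0] by simp
qed

lemma tangent_add:
  "v \<in> tangent_space M p \<Longrightarrow> f \<in> smooth_funs M \<Longrightarrow> g \<in> smooth_funs M \<Longrightarrow> v (\<lambda>x. f x + g x) = v f + v g"
  using tangent_lincomb[of v p f g 1 1] by simp

lemma tangent_cmult:
  "v \<in> tangent_space M p \<Longrightarrow> f \<in> smooth_funs M \<Longrightarrow> v (\<lambda>x. a * f x) = a * v f"
  using tangent_lincomb[of v p f f a 0] by simp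

lemma tangent_sum:
  assumes v: "v \<in> tangent_space M p" and f: "\<And>i. i \<in> I \<Longrightarrow> f i \<in> smooth_funs M"
  shows "v (\<lambda>x. \<Sum>i\<in>I. f i x) = (\<Sum>i\<in>I. v (f i))"
  using f
proof (induction I rule: infinite_finite_induct)
  case (insert i I)
  then have "v (\<lambda>x. f i x + (\<Sum>j\<in>I. f j x)) = v (f i) + v (\<lambda>x. \<Sum>j\<in>I. f j x)"
    by (intro tangent_add[OF v] smooth_funs_sum) auto
  then show ?case using insert by simp
qed (auto simp: tangent_const[OF v])

text \<open>With a cutoff \<open>\<beta>\<close> vanishing outside \<open>W\<close>, the function
  \<open>\<beta> * (f - g)\<close> is zero everywhere. The Leibniz rule at \<open>p\<close>, where
  \<open>\<beta> p = 1\<close> and \<open>f p = g p\<close>, leaves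
  \<open>v (f - g) = 0\<close>.\<close>

lemma tangent_local:
  assumes v: "v \<in> tangent_space M p" and f: "f \<in> smooth_funs M" and g: "g \<in> smooth_funs M"
    and W: "openin (mtop M) W" "p \<in> W" "\<And>q. q \<in> W \<Longrightarrow> f q = g q"
  shows "v f = v g"
proof -
  have "p \<in> points M" using W openin_subset by blast
  then obtain U h where U: "(U, h) \<in> atlas M" "p \<in> U" using chart_at by blast
  obtain \<beta> K W' where *: "\<beta> \<in> smooth_funs M" "closedin (mtop M) K" "K \<subseteq> W" "K \<subseteq> U"
    "\<And>q. q \<notin> K \<Longrightarrow> \<beta> q = 0" "openin (mtop M) W'" "p \<in> W'" "W' \<subseteq> K" "\<And>q. q \<in> W' \<Longrightarrow> \<beta> q = (1::real)"
    using cutoff_exists[OF U W(1,2)] by metis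
  \<comment> \<open>The difference is written as \<open>1 * f x + (- 1) * g x\<close> to match the
    linearity clause of \<open>tangent_space\<close> literally.\<close>
  have "(\<lambda>x. \<beta> x * (1 * f x + (- 1) * g x)) = (\<lambda>x. 0)"
    using *(3,5) W(3) by (fastforce simp: fun_eq_iff)
  moreover have "(\<lambda>x. 1 * f x + (- 1) * g x) \<in> smooth_funs M"
    using smooth_funs_diff[OF f g] by simp
  ultimately have "0 = \<beta> p * v (\<lambda>x. 1 * f x + (- 1) * g x) + (1 * f p + (- 1) * g p) * v \<beta>"
    using tangent_mult[OF v *(1), of "\<lambda>x. 1 * f x + (- 1) * g x"] tangent_const[OF v, of 0] by simp
  then have "v (\<lambda>x. 1 * f x + (- 1) * g x) = 0" using *(7,9) W(2,3) by simp
  then show ?thesis unfolding tangent_lincomb[OF v f g] by simp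
qed

text \<open>Differentiating along lines inside the model space makes the definition independent of a
  choice of smooth local extension of \<open>f \<circ> h\<inverse>\<close> to an open set.\<close>

definition chart_vector :: "'a set \<Rightarrow> ('a \<Rightarrow> 'e) \<Rightarrow> 'a \<Rightarrow> 'e \<Rightarrow> 'a tvec" where
  "chart_vector U h q \<xi> = (\<lambda>f. if f \<in> smooth_funs M
     then deriv (\<lambda>t. f (inv_into U h (h q + t *\<^sub>R \<xi>))) 0 else 0)"

text \<open>The line \<open>h q + t *\<^sub>R \<xi>\<close> stays in \<open>E\<close>, and for small
  \<open>t\<close> in the open set that cuts out the chart image. There \<open>F\<close> agrees with
  \<open>f\<close> in coordinates, so every representative \<open>F\<close> has the same directional
  derivative along \<open>E\<close>.\<close>

lemma chart_vector_eq:
  assumes U: "(U, h) \<in> atlas M" "q \<in> U" and \<xi>: "\<xi> \<in> E" and f: "f \<in> smooth_funs M"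
    and F: "h q \<in> G" "smooth_on_open G F" "\<And>x. x \<in> U \<Longrightarrow> h x \<in> G \<Longrightarrow> f x = F (h x)"
  shows "chart_vector U h q \<xi> f = frechet_derivative F (at (h q)) \<xi>"
proof -
  obtain O' where O': "open O'" "h ` U = E \<inter> O'"
    using chart_image_open[OF U(1), of U] chart U(1) by blast
  let ?S = "(\<lambda>t. h q + t *\<^sub>R \<xi>) -` (O' \<inter> G)"
  have S: "open ?S"
    using O'(1) F(2) by (intro continuous_open_vimage) (auto intro!: continuous_intros simp: smooth_on_open_def)
  have eq: "F (h q + t *\<^sub>R \<xi>) = f (inv_into U h (h q + t *\<^sub>R \<xi>))" if "t \<in> ?S" for t
  proof -
    have "h q + t *\<^sub>R \<xi> \<in> E"
      using chart_in_E[OF U] \<xi> subspace_E by (intro subspace_add subspace_scale) auto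
    then have "h q + t *\<^sub>R \<xi> \<in> h ` U" using O'(2) that by auto
    then show ?thesis using F(3) that by (metis IntE f_inv_into_f inv_into_into vimageE)
  qed
  have dF: "(F has_derivative frechet_derivative F (at (h q))) (at (h q + 0 *\<^sub>R \<xi>))"
    using smooth_on_open_has_derivative[OF F(2,1)] by simp
  have "((\<lambda>t. F (h q + t *\<^sub>R \<xi>)) has_derivative (\<lambda>s. frechet_derivative F (at (h q)) (s *\<^sub>R \<xi>))) (at 0)"
    by (rule has_derivative_compose[where f = "\<lambda>t. h q + t *\<^sub>R \<xi>", OF _ dF])
      (auto intro!: derivative_eq_intros)
  then have "((\<lambda>t. F (h q + t *\<^sub>R \<xi>)) has_field_derivative frechet_derivative F (at (h q)) \<xi>) (at 0)"
    unfolding has_field_derivative_def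
    by (rule has_derivative_eq_rhs)
      (simp add: fun_eq_iff linear_scale[OF bounded_linear.linear[OF has_derivative_bounded_linear[OF dF]]])
  then have "((\<lambda>t. f (inv_into U h (h q + t *\<^sub>R \<xi>))) has_field_derivative frechet_derivative F (at (h q)) \<xi>) (at 0)"
    by (rule has_field_derivative_transform_within_open[OF _ S]) (use O'(2) U(2) F(1) eq in auto)
  then show ?thesis unfolding chart_vector_def using f by (simp add: DERIV_imp_deriv)
qed

lemma chart_vector_tangent:
  assumes U: "(U, h) \<in> atlas M" "q \<in> U" and \<xi>: "\<xi> \<in> E"
  shows "chart_vector U h q \<xi> \<in> tangent_space M q"
  unfolding tangent_space_def
proof (intro CollectI conjI ballI allI impI)
  fix f g a b assume f: "f \<in> smooth_funs M" and g: "g \<in> smooth_funs M"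
  obtain G F where F: "h q \<in> G" "smooth_on_open G F" "\<And>x. x \<in> U \<Longrightarrow> h x \<in> G \<Longrightarrow> f x = F (h x)"
    using smooth_funsE[OF f U] by blast
  obtain G' F' where F': "h q \<in> G'" "smooth_on_open G' F'" "\<And>x. x \<in> U \<Longrightarrow> h x \<in> G' \<Longrightarrow> g x = F' (h x)"
    using smooth_funsE[OF g U] by blast
  have op: "open (G \<inter> G')" using F(2) F'(2) by (auto simp: smooth_on_open_def)
  have s: "smooth_on_open (G \<inter> G') F" "smooth_on_open (G \<inter> G') F'"
    using smooth_on_open_subset[OF F(2) op] smooth_on_open_subset[OF F'(2) op] by auto
  note d = smooth_on_open_has_derivative[OF F(2,1)] smooth_on_open_has_derivative[OF F'(2,1)]
  let ?D = "frechet_derivative F (at (h q)) \<xi>" and ?D' = "frechet_derivative F' (at (h q)) \<xi>"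
  have vf: "chart_vector U h q \<xi> f = ?D" by (rule chart_vector_eq[OF U \<xi> f F])
  have vg: "chart_vector U h q \<xi> g = ?D'" by (rule chart_vector_eq[OF U \<xi> g F'])
  show "chart_vector U h q \<xi> (\<lambda>x. a * f x + b * g x) =
      a * chart_vector U h q \<xi> f + b * chart_vector U h q \<xi> g"
  proof -
    have "((\<lambda>y. a * F y + b * F' y) has_derivative
        (\<lambda>v. a * frechet_derivative F (at (h q)) v + b * frechet_derivative F' (at (h q)) v)) (at (h q))"
      using d by (auto intro!: derivative_eq_intros)
    then have "frechet_derivative (\<lambda>y. a * F y + b * F' y) (at (h q)) =
        (\<lambda>v. a * frechet_derivative F (at (h q)) v + b * frechet_derivative F' (at (h q)) v)"
      by (metis frechet_derivative_at)
    moreover have "chart_vector U h q \<xi> (\<lambda>x. a * f x + b * g x) =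
        frechet_derivative (\<lambda>y. a * F y + b * F' y) (at (h q)) \<xi>"
    proof (rule chart_vector_eq[OF U \<xi>])
      show "(\<lambda>x. a * f x + b * g x) \<in> smooth_funs M"
        by (intro smooth_funs_add smooth_funs_mult smooth_funs_const f g)
      show "smooth_on_open (G \<inter> G') (\<lambda>y. a * F y + b * F' y)"
        by (intro smooth_on_open_add smooth_on_open_bilinear[OF bounded_bilinear_mult]
            smooth_on_open_const op s)
    qed (use F F' in auto)
    ultimately show ?thesis using vf vg by simp
  qed
  show "chart_vector U h q \<xi> (\<lambda>x. f x * g x) =
      f q * chart_vector U h q \<xi> g + g q * chart_vector U h q \<xi> f"
  proof -
    have "((\<lambda>y. F y * F' y) has_derivative
        (\<lambda>v. F (h q) * frechet_derivative F' (at (h q)) v + frechet_derivative F (at (h q)) v * F' (h q))) (at (h q))"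
      using d by (auto intro!: derivative_eq_intros)
    then have "frechet_derivative (\<lambda>y. F y * F' y) (at (h q)) =
        (\<lambda>v. F (h q) * frechet_derivative F' (at (h q)) v + frechet_derivative F (at (h q)) v * F' (h q))"
      by (metis frechet_derivative_at)
    moreover have "chart_vector U h q \<xi> (\<lambda>x. f x * g x) =
        frechet_derivative (\<lambda>y. F y * F' y) (at (h q)) \<xi>"
    proof (rule chart_vector_eq[OF U \<xi>])
      show "(\<lambda>x. f x * g x) \<in> smooth_funs M" by (intro smooth_funs_mult f g)
      show "smooth_on_open (G \<inter> G') (\<lambda>y. F y * F' y)"
        by (intro smooth_on_open_bilinear[OF bounded_bilinear_mult] s)
    qed (use F F' in auto)
    ultimately show ?thesis using vf vg F(1,3) F'(1,3) U(2) by simp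
  qed
qed (simp add: chart_vector_def)

text \<open>Hadamard's lemma writes \<open>f\<close> near \<open>q\<close> as a constant plus
  products of \<open>c b - c b q\<close> with smooth functions. The first factors vanish at
  \<open>q\<close>, so the Leibniz rule keeps only \<open>v (c b)\<close> times the value of the
  second factor, which is a partial derivative of \<open>F\<close>.\<close>

lemma tangent_eq_frechet:
  assumes U: "(U, h) \<in> atlas M" "q \<in> U" and v: "v \<in> tangent_space M q"
    and c: "\<And>b. b \<in> Basis \<Longrightarrow> c b \<in> smooth_funs M"
    and W: "openin (mtop M) W" "q \<in> W" "W \<subseteq> U" "\<And>b x. b \<in> Basis \<Longrightarrow> x \<in> W \<Longrightarrow> c b x = h x \<bullet> b"
    and f: "f \<in> smooth_funs M"
    and F: "h q \<in> G" "smooth_on_open G F" "\<And>x. x \<in> U \<Longrightarrow> h x \<in> G \<Longrightarrow> f x = F (h x)"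
  shows "v f = frechet_derivative F (at (h q)) (\<Sum>b\<in>Basis. v (c b) *\<^sub>R b)"
proof -
  have "open G" using F(2) by (simp add: smooth_on_open_def)
  then obtain r where r: "0 < r" "ball (h q) r \<subseteq> G" using F(1) open_contains_ball by blast
  obtain H where H: "\<And>b. smooth_on_open (ball (h q) r) (H b)"
    "\<And>x. x \<in> ball (h q) r \<Longrightarrow> F x = F (h q) + (\<Sum>b\<in>Basis. ((x - h q) \<bullet> b) * H b x)"
    "\<And>b. H b (h q) = frechet_derivative F (at (h q)) b"
    using Hadamard_lemma[OF smooth_on_open_subset[OF F(2) open_ball r(2)]] r(1) by metis
  let ?N = "{x \<in> U. h x \<in> ball (h q) r}"
  obtain \<beta> K W' where *: "\<beta> \<in> smooth_funs M" "closedin (mtop M) K" "K \<subseteq> ?N" "K \<subseteq> U"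
    "\<And>q. q \<notin> K \<Longrightarrow> \<beta> q = 0" "openin (mtop M) W'" "q \<in> W'" "W' \<subseteq> K" "\<And>q. q \<in> W' \<Longrightarrow> \<beta> q = (1::real)"
    by (rule cutoff_exists[OF U chart_preimage_open[OF U(1) open_ball, of "h q" r]]) (use U r(1) in auto)
  let ?g = "\<lambda>b x. \<beta> x * H b (h x)"
  let ?k = "\<lambda>b x. c b x - c b q"
  have g: "?g b \<in> smooth_funs M" for b
    by (rule cutoff_extension[OF U(1) *(1,5,2,3) H(1)])
  have k: "?k b \<in> smooth_funs M" if "b \<in> Basis" for b
    using smooth_funs_diff[OF c[OF that] smooth_funs_const] .
  let ?f = "\<lambda>x. F (h q) + (\<Sum>b\<in>Basis. ?k b x * ?g b x)"
  have s: "(\<lambda>x. \<Sum>b\<in>Basis. ?k b x * ?g b x) \<in> smooth_funs M"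
    by (intro smooth_funs_sum smooth_funs_mult k g)
  have "v f = v ?f"
  proof (rule tangent_local[OF v f smooth_funs_add[OF smooth_funs_const s] openin_Int[OF W(1) *(6)]])
    show "q \<in> W \<inter> W'" using W *(7) by blast
    fix x assume x: "x \<in> W \<inter> W'"
    then have "h x \<in> ball (h q) r" "x \<in> U" using *(3,8) by auto
    then have "f x = F (h q) + (\<Sum>b\<in>Basis. ((h x - h q) \<bullet> b) * H b (h x))"
      using F(3)[of x] r(2) H(2)[of "h x"] by auto
    also have "\<dots> = ?f x"
      using x *(9)[of x] W(2,4) by (auto simp: inner_diff_left intro!: sum.cong)
    finally show "f x = ?f x" .
  qed
  also have "\<dots> = (\<Sum>b\<in>Basis. v (\<lambda>x. ?k b x * ?g b x))"
    using tangent_add[OF v smooth_funs_const s, of "F (h q)"] tangent_const[OF v]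
      tangent_sum[OF v, of Basis "\<lambda>b x. ?k b x * ?g b x"] smooth_funs_mult[OF k g] by simp
  also have "\<dots> = (\<Sum>b\<in>Basis. v (c b) * frechet_derivative F (at (h q)) b)"
  proof (rule sum.cong)
    fix b :: 'e assume b: "b \<in> Basis"
    have "v (?k b) = v (c b)"
      using tangent_lincomb[OF v c[OF b] smooth_funs_const, of 1 "- c b q" 1] tangent_const[OF v, of 1] by simp
    then show "v (\<lambda>x. ?k b x * ?g b x) = v (c b) * frechet_derivative F (at (h q)) b"
      using tangent_mult[OF v k[OF b] g] *(7,9) H(3) by simp
  qed simp
  also have "\<dots> = frechet_derivative F (at (h q)) (\<Sum>b\<in>Basis. v (c b) *\<^sub>R b)"
    using bounded_linear.linear[OF has_derivative_bounded_linear[OF smooth_on_open_has_derivative[OF F(2,1)]]]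
    by (simp add: linear_sum linear_scale)
  finally show ?thesis .
qed

text \<open>A direction \<open>e\<close> orthogonal to \<open>E\<close> gives the linear relation
  \<open>h x \<bullet> e = 0\<close> between the coordinates near \<open>q\<close>. Applying
  \<open>v\<close> to it shows that the coordinate vector of \<open>v\<close> is orthogonal to
  \<open>e\<close> as well; the double complement of \<open>E\<close> is \<open>E\<close>.\<close>

lemma tangent_coordinates_in_E:
  assumes U: "(U, h) \<in> atlas M" "q \<in> U" and v: "v \<in> tangent_space M q"
    and c: "\<And>b. b \<in> Basis \<Longrightarrow> c b \<in> smooth_funs M"
    and W: "openin (mtop M) W" "q \<in> W" "W \<subseteq> U" "\<And>b x. b \<in> Basis \<Longrightarrow> x \<in> W \<Longrightarrow> c b x = h x \<bullet> b"
  shows "(\<Sum>b\<in>Basis. v (c b) *\<^sub>R b) \<in> E"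
proof -
  have "(\<Sum>b\<in>Basis. v (c b) *\<^sub>R b) \<bullet> e = 0" if e: "e \<in> orthogonal_comp E" for e
  proof -
    have "(\<Sum>b\<in>Basis. v (c b) *\<^sub>R b) \<bullet> e = (\<Sum>b\<in>Basis. v (\<lambda>x. (b \<bullet> e) * c b x))"
      using tangent_cmult[OF v c] by (simp add: inner_sum_left mult.commute)
    also have "\<dots> = v (\<lambda>x. \<Sum>b\<in>Basis. (b \<bullet> e) * c b x)"
      by (rule tangent_sum[OF v, symmetric]) (intro smooth_funs_mult smooth_funs_const c)
    also have "\<dots> = v (\<lambda>x. 0)"
    proof (rule tangent_local[OF v _ smooth_funs_const W(1,2)])
      show "(\<lambda>x. \<Sum>b\<in>Basis. (b \<bullet> e) * c b x) \<in> smooth_funs M"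
        by (intro smooth_funs_sum smooth_funs_mult smooth_funs_const c)
      fix x assume x: "x \<in> W"
      have "(\<Sum>b\<in>Basis. (b \<bullet> e) * c b x) = h x \<bullet> e"
        using W(4) x by (subst euclidean_inner) (simp add: inner_commute mult.commute)
      also have "\<dots> = 0"
        using e chart_in_E[OF U(1), of x] W(3) x by (auto simp: orthogonal_comp_def orthogonal_def)
      finally show "(\<Sum>b\<in>Basis. (b \<bullet> e) * c b x) = 0" .
    qed
    also have "\<dots> = 0" by (rule tangent_const[OF v])
    finally show ?thesis .
  qed
  then have "(\<Sum>b\<in>Basis. v (c b) *\<^sub>R b) \<in> orthogonal_comp (orthogonal_comp E)"
    by (auto simp: orthogonal_comp_def orthogonal_def inner_commute)
  then show ?thesis using orthogonal_comp_self[OF subspace_E] by simp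
qed

lemma tangent_eq_chart_vector:
  assumes U: "(U, h) \<in> atlas M" "q \<in> U" and v: "v \<in> tangent_space M q"
    and c: "\<And>b. b \<in> Basis \<Longrightarrow> c b \<in> smooth_funs M"
    and W: "openin (mtop M) W" "q \<in> W" "W \<subseteq> U" "\<And>b x. b \<in> Basis \<Longrightarrow> x \<in> W \<Longrightarrow> c b x = h x \<bullet> b"
  shows "v = chart_vector U h q (\<Sum>b\<in>Basis. v (c b) *\<^sub>R b)"
proof
  fix f
  show "v f = chart_vector U h q (\<Sum>b\<in>Basis. v (c b) *\<^sub>R b) f"
  proof (cases "f \<in> smooth_funs M")
    case True
    obtain G F where F: "h q \<in> G" "smooth_on_open G F" "\<And>x. x \<in> U \<Longrightarrow> h x \<in> G \<Longrightarrow> f x = F (h x)"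
      using smooth_funsE[OF True U] by blast
    show ?thesis
      using tangent_eq_frechet[OF assms True F] chart_vector_eq[OF U tangent_coordinates_in_E[OF assms] True F] by simp
  next
    case False
    then show ?thesis using tangent_nonsmooth[OF v] by (simp add: chart_vector_def)
  qed
qed

section \<open>Representation of functionals and the gradient\<close>

lemma tangent_space_lincomb:
  assumes "u \<in> tangent_space M p" "v \<in> tangent_space M p"
  shows "(\<lambda>f. a * u f + b * v f) \<in> tangent_space M p"
  using assms unfolding tangent_space_def
  by (auto simp: algebra_simps)

lemma zero_tangent: "(\<lambda>f. 0) \<in> tangent_space M p"
  by (simp add: tangent_space_def)

text \<open>A tangent space is a set of HOL functions, so the linear algebra is transported to a
  subspace of Euclidean space: \<open>x\<close> reads off coordinates, and \<open>j\<close> inverts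
  it on tangent vectors. The functional \<open>l\<close> is general because both the gradient and
  the tangential projection are obtained from it.\<close>

lemma tangent_functional_represented:
  assumes p: "p \<in> points M" and g: "pseudo_riemannian_metric M g"
    and l: "\<And>u v a b. u \<in> tangent_space M p \<Longrightarrow> v \<in> tangent_space M p \<Longrightarrow>
      l (\<lambda>f. a * u f + b * v f) = a * l u + b * l v"
  obtains u where "u \<in> tangent_space M p" "\<forall>v\<in>tangent_space M p. g p u v = l v"
proof -
  let ?T = "tangent_space M p"
  obtain U h where U: "(U, h) \<in> atlas M" "p \<in> U" using chart_at[OF p] by blast
  obtain c W where c: "\<And>b. c b \<in> smooth_funs M" "openin (mtop M) W" "p \<in> W" "W \<subseteq> U"
    "\<And>b q. q \<in> W \<Longrightarrow> c b q = h q \<bullet> b"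
    using coordinate_functions_exist[OF U] by metis
  define x where "x v = (\<Sum>b\<in>Basis. v (c b) *\<^sub>R b)" for v :: "'a tvec"
  define j where "j = chart_vector U h p"
  have jx: "j (x v) = v" if "v \<in> ?T" for v
    unfolding j_def x_def using tangent_eq_chart_vector[OF U that c(1,2,3,4,5)] by simp
  have x_lin: "x (\<lambda>f. a * u f + b * v f) = a *\<^sub>R x u + b *\<^sub>R x v" for a b u v
    by (simp add: x_def scaleR_add_left sum.distrib scaleR_sum_right)
  have j_lin: "j (a *\<^sub>R s + b *\<^sub>R t) = (\<lambda>f. a * j s f + b * j t f)" "j s \<in> ?T" "x (j s) = s"
    if st: "s \<in> x ` ?T" "t \<in> x ` ?T" for s t a b
  proof -
    obtain u v where uv: "u \<in> ?T" "v \<in> ?T" "s = x u" "t = x v" using st by blast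
    show "j (a *\<^sub>R s + b *\<^sub>R t) = (\<lambda>f. a * j s f + b * j t f)"
      using jx[OF tangent_space_lincomb[OF uv(1,2), of a b]] jx uv by (simp add: x_lin)
    show "j s \<in> ?T" "x (j s) = s" using jx uv by auto
  qed
  have S: "subspace (x ` ?T)"
  proof (rule subspaceI)
    show "0 \<in> x ` ?T" using zero_tangent[of p] by (force simp: x_def)
    show "s + t \<in> x ` ?T" if st: "s \<in> x ` ?T" "t \<in> x ` ?T" for s t
    proof -
      obtain u v where uv: "u \<in> ?T" "v \<in> ?T" "s = x u" "t = x v" using st by blast
      have "x (\<lambda>f. 1 * u f + 1 * v f) = s + t" unfolding x_lin using uv by simp
      then show ?thesis using tangent_space_lincomb[OF uv(1,2), of 1 1] by (metis (no_types, lifting) imageI)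
    qed
    show "a *\<^sub>R s \<in> x ` ?T" if s: "s \<in> x ` ?T" for a s
    proof -
      obtain u where u: "u \<in> ?T" "s = x u" using s by blast
      have "x (\<lambda>f. a * u f + 0 * u f) = a *\<^sub>R s" unfolding x_lin using u by simp
      then show ?thesis using tangent_space_lincomb[OF u(1) u(1), of a 0] by (metis (no_types, lifting) imageI)
    qed
  qed
  obtain s where s: "s \<in> x ` ?T" "\<And>t. t \<in> x ` ?T \<Longrightarrow> g p (j s) (j t) = l (j t)"
  proof (rule nondegenerate_form_represents[OF S, of "\<lambda>s t. g p (j s) (j t)" "\<lambda>t. l (j t)"])
    fix s t w a b assume "s \<in> x ` ?T" "t \<in> x ` ?T" "w \<in> x ` ?T"
    then show "g p (j (a *\<^sub>R s + b *\<^sub>R t)) (j w) = a * g p (j s) (j w) + b * g p (j t) (j w)"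
      using g p j_lin unfolding pseudo_riemannian_metric_def by simp
  next
    fix s t assume "s \<in> x ` ?T" "t \<in> x ` ?T"
    then show "g p (j s) (j t) = g p (j t) (j s)"
      using g p j_lin(2) unfolding pseudo_riemannian_metric_def by blast
  next
    fix s assume s: "s \<in> x ` ?T" and "\<And>t. t \<in> x ` ?T \<Longrightarrow> g p (j s) (j t) = 0"
    then have "g p (j s) v = 0" if "v \<in> ?T" for v using jx[OF that] that by (metis imageI)
    then have "j s = (\<lambda>f. 0)"
      using g p j_lin(2)[OF s s] unfolding pseudo_riemannian_metric_def by blast
    moreover have "x (\<lambda>f. 0) = 0" by (simp add: x_def)
    ultimately show "s = 0" using j_lin(3)[OF s s] by simp
  next
    fix s t a b assume "s \<in> x ` ?T" "t \<in> x ` ?T"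
    then show "l (j (a *\<^sub>R s + b *\<^sub>R t)) = a * l (j s) + b * l (j t)"
      using j_lin l by simp
  next
    fix s assume "s \<in> x ` ?T" "\<And>t. t \<in> x ` ?T \<Longrightarrow> g p (j s) (j t) = l (j t)"
    then show thesis by (rule that)
  qed
  show ?thesis
  proof
    show "j s \<in> ?T" using j_lin(2)[OF s(1) s(1)] .
    show "\<forall>v\<in>?T. g p (j s) v = l v" using s(2) jx by (metis imageI)
  qed
qed

text \<open>Discharges the definite description in \<open>grad\<close>: existence by representing
  the functional that sends \<open>v\<close> to \<open>v \<psi>\<close>, uniqueness by
  non-degeneracy applied to the difference of two candidates.\<close>

lemma grad_represents:
  assumes p: "p \<in> points M" and g: "pseudo_riemannian_metric M g" and \<psi>: "\<psi> \<in> smooth_funs M"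
  shows "grad M g \<psi> p \<in> tangent_space M p"
    and "\<And>v. v \<in> tangent_space M p \<Longrightarrow> g p (grad M g \<psi> p) v = v \<psi>"
proof -
  let ?Q = "\<lambda>u. u \<in> tangent_space M p \<and> (\<forall>v\<in>tangent_space M p. g p u v = v \<psi>)"
  obtain u where u: "?Q u"
    using tangent_functional_represented[OF p g, of "\<lambda>v. v \<psi>"] by blast
  have uniq: "u' = u" if u': "?Q u'" for u'
  proof -
    let ?d = "\<lambda>f. 1 * u' f + (- 1) * u f"
    have "?d \<in> tangent_space M p" using tangent_space_lincomb u u' by blast
    moreover have "g p ?d v = 0" if v: "v \<in> tangent_space M p" for v
    proof -
      have "g p ?d v = 1 * g p u' v + (- 1) * g p u v"
        using g p u u' v unfolding pseudo_riemannian_metric_def by blast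
      then show ?thesis using u u' v by simp
    qed
    ultimately have "?d = (\<lambda>f. 0)" using g p unfolding pseudo_riemannian_metric_def by blast
    then show ?thesis by (auto simp: fun_eq_iff)
  qed
  have "(THE u. ?Q u) = u" by (rule the_equality[where P = ?Q, OF u uniq])
  then have "grad M g \<psi> p = u" using p by (simp add: grad_def)
  then show "grad M g \<psi> p \<in> tangent_space M p"
    and "\<And>v. v \<in> tangent_space M p \<Longrightarrow> g p (grad M g \<psi> p) v = v \<psi>" using u by auto
qed

end

subsection \<open>Immersed submanifolds\<close>

locale immersed_submanifold =
  M: smooth_mfd M E + M': smooth_mfd M' E'
  for M :: "('a, 'e::euclidean_space) manifold" and E
    and M' :: "('a, 'f::euclidean_space) manifold" and E' +
  assumes points_subset: "points M' \<subseteq> points M"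
    and inclusion_smooth: "smooth_map M' M (\<lambda>x. x)"
    and immersion: "p \<in> points M' \<Longrightarrow> inj_on (incl M) (tangent_space M' p)"
begin

lemma openin_restrict:
  assumes "openin (mtop M) W" shows "openin (mtop M') (W \<inter> points M')"
proof -
  have "openin (mtop M') {x \<in> points M'. x \<in> W}"
    using inclusion_smooth assms unfolding smooth_map_def by (auto intro: openin_continuous_map_preimage)
  then show ?thesis by (simp add: Int_def conj_commute)
qed

text \<open>Continuity of the inclusion makes \<open>U \<inter> V\<close> open in \<open>M'\<close>,
  so the domain can be shrunk until every chart point with coordinates in \<open>G\<close> lies in
  \<open>V\<close>. This covers topologies on \<open>M'\<close> finer than the subspace
  topology.\<close>

lemma inclusion_local_rep:
  assumes U: "(U, h) \<in> atlas M'" "p \<in> U" and V: "(V, k) \<in> atlas M" "p \<in> V"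
  obtains G T where "h p \<in> G" "smooth_on_open G T" "\<And>q. q \<in> U \<Longrightarrow> h q \<in> G \<Longrightarrow> q \<in> V \<and> T (h q) = k q"
proof -
  have UV: "{q \<in> U. q \<in> V} = U \<inter> (V \<inter> points M')" using M'.chart_subset[OF U(1)] by blast
  have "openin (mtop M') {q \<in> U. q \<in> V}"
    unfolding UV using M'.chart[OF U(1)] M.chart[OF V(1)] openin_restrict by blast
  then obtain O' where O': "open O'" "h ` {q \<in> U. q \<in> V} = E' \<inter> O'"
    using M'.chart_image_open[OF U(1)] by (metis (no_types, lifting) mem_Collect_eq subsetI)
  have "smooth_on (h ` {q \<in> U. q \<in> V}) (k \<circ> (\<lambda>x. x) \<circ> inv_into U h)"
    using inclusion_smooth U(1) V(1) unfolding smooth_map_def by blast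
  moreover have hp: "h p \<in> h ` {q \<in> U. q \<in> V}" using U(2) V(2) by blast
  ultimately obtain G T where T: "h p \<in> G" "smooth_on_open G T"
    "\<forall>y\<in>h ` {q \<in> U. q \<in> V} \<inter> G. T y = (k \<circ> (\<lambda>x. x) \<circ> inv_into U h) y"
    unfolding smooth_on_iff by blast
  show ?thesis
  proof
    show "h p \<in> G \<inter> O'" using T(1) hp O'(2) by blast
    show "smooth_on_open (G \<inter> O') T"
      using smooth_on_open_subset[OF T(2), of "G \<inter> O'"] T(2) O'(1) by (simp add: smooth_on_open_def open_Int)
    show "q \<in> V \<and> T (h q) = k q" if q: "q \<in> U" "h q \<in> G \<inter> O'" for q
    proof -
      have "q \<in> {q \<in> U. q \<in> V}" using M'.chart_imageD[OF U(1) _ O'(2) q(1)] q(2) by blast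
      then show ?thesis using T(3) q U(1) by auto
    qed
  qed
qed

lemma smooth_funs_restrict:
  assumes f: "f \<in> smooth_funs M" shows "f \<in> smooth_funs M'"
proof (rule M'.smooth_funsI)
  fix p assume p: "p \<in> points M'"
  obtain U h where U: "(U, h) \<in> atlas M'" "p \<in> U" using M'.chart_at[OF p] by blast
  obtain V k where V: "(V, k) \<in> atlas M" "p \<in> V" using M.chart_at[of p] p points_subset by blast
  obtain G T where T: "h p \<in> G" "smooth_on_open G T" "\<And>q. q \<in> U \<Longrightarrow> h q \<in> G \<Longrightarrow> q \<in> V \<and> T (h q) = k q"
    using inclusion_local_rep[OF U V] by metis
  obtain G' F where F: "k p \<in> G'" "smooth_on_open G' F" "\<And>q. q \<in> V \<Longrightarrow> k q \<in> G' \<Longrightarrow> f q = F (k q)"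
    using M.smooth_funsE[OF f V] by metis
  have op: "open {x \<in> G. T x \<in> G'}"
    using smooth_on_open_preimage[OF T(2)] F(2) by (simp add: smooth_on_open_def)
  show "M'.smooth_at f p"
  proof (rule M'.smooth_atI[OF U])
    show "h p \<in> {x \<in> G. T x \<in> G'}" using T(1,3) U(2) F(1) by simp
    show "smooth_on_open {x \<in> G. T x \<in> G'} (\<lambda>x. F (T x))"
      by (rule smooth_on_open_compose[OF F(2) smooth_on_open_subset[OF T(2) op]]) auto
    show "f q = F (T (h q))" if "q \<in> U" "h q \<in> {x \<in> G. T x \<in> G'}" for q
      using T(3)[of q] F(3)[of q] that by simp
  qed
qed

text \<open>A pushforward along the identity only forgets the values of \<open>v\<close> on
  functions that are not smooth on \<open>M\<close>; many of these may be smooth on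
  \<open>M'\<close>.\<close>

lemma incl_eq: "incl M v = (\<lambda>f. if f \<in> smooth_funs M then v f else 0)"
  unfolding differential_def comp_def ..

lemma incl_tangent:
  assumes "v \<in> tangent_space M' p" shows "incl M v \<in> tangent_space M p"
  unfolding incl_eq tangent_space_def
  using M'.tangent_lincomb[OF assms smooth_funs_restrict smooth_funs_restrict]
    M'.tangent_mult[OF assms smooth_funs_restrict smooth_funs_restrict]
    M.smooth_funs_add[OF M.smooth_funs_mult[OF M.smooth_funs_const] M.smooth_funs_mult[OF M.smooth_funs_const]]
    M.smooth_funs_mult by auto

lemma incl_lincomb: "incl M (\<lambda>f. a * u f + b * v f) = (\<lambda>f. a * incl M u f + b * incl M v f)"
  by (auto simp: incl_eq)

text \<open>A kernel direction \<open>\<zeta>\<close> yields, by the chain rule, a derivation on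
  \<open>M'\<close> that kills all smooth functions of \<open>M\<close>. Injectivity of
  \<open>incl M\<close> makes it zero, and testing it on the coordinate functions of
  \<open>M'\<close> gives \<open>\<zeta> = 0\<close>.\<close>

lemma immersion_derivative_injective:
  assumes U: "(U, h) \<in> atlas M'" "p \<in> U" and V: "(V, k) \<in> atlas M" "p \<in> V"
    and T: "h p \<in> G" "smooth_on_open G T" "\<And>q. q \<in> U \<Longrightarrow> h q \<in> G \<Longrightarrow> q \<in> V \<and> T (h q) = k q"
    and \<zeta>: "\<zeta> \<in> E'" "frechet_derivative T (at (h p)) \<zeta> = 0"
  shows "\<zeta> = 0"
proof -
  have p: "p \<in> points M'" using M'.chart_subset[OF U(1)] U(2) by blast
  let ?v = "M'.chart_vector U h p \<zeta>"
  have v: "?v \<in> tangent_space M' p" by (rule M'.chart_vector_tangent[OF U \<zeta>(1)])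
  have "?v f = 0" if f: "f \<in> smooth_funs M" for f
  proof -
    obtain G' F where F: "k p \<in> G'" "smooth_on_open G' F" "\<And>q. q \<in> V \<Longrightarrow> k q \<in> G' \<Longrightarrow> f q = F (k q)"
      using M.smooth_funsE[OF f V] by metis
    have op: "open {x \<in> G. T x \<in> G'}"
      using smooth_on_open_preimage[OF T(2)] F(2) by (simp add: smooth_on_open_def)
    have Tp: "T (h p) = k p" using T(1,3) U(2) by simp
    have "?v f = frechet_derivative (\<lambda>x. F (T x)) (at (h p)) \<zeta>"
    proof (rule M'.chart_vector_eq[OF U \<zeta>(1) smooth_funs_restrict[OF f]])
      show "h p \<in> {x \<in> G. T x \<in> G'}" using T(1) Tp F(1) by simp
      show "smooth_on_open {x \<in> G. T x \<in> G'} (\<lambda>x. F (T x))"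
        by (rule smooth_on_open_compose[OF F(2) smooth_on_open_subset[OF T(2) op]]) auto
      show "f q = F (T (h q))" if "q \<in> U" "h q \<in> {x \<in> G. T x \<in> G'}" for q
        using T(3)[of q] F(3)[of q] that by simp
    qed
    also have "frechet_derivative (\<lambda>x. F (T x)) (at (h p)) =
        (\<lambda>v. frechet_derivative F (at (k p)) (frechet_derivative T (at (h p)) v))"
      by (rule frechet_derivative_at[symmetric], rule has_derivative_compose[where f = T])
        (use smooth_on_open_has_derivative[OF T(2,1)] smooth_on_open_has_derivative[OF F(2,1)] Tp in auto)
    finally show ?thesis
      using \<zeta>(2) linear_0[OF bounded_linear.linear[OF has_derivative_bounded_linear
            [OF smooth_on_open_has_derivative[OF F(2,1)]]]] by simp
  qed
  then have "incl M ?v = incl M (\<lambda>f. 0)" by (auto simp: incl_eq)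
  then have v0: "?v = (\<lambda>f. 0)" using immersion[OF p] v M'.zero_tangent by (meson inj_onD)
  obtain c W where c: "\<And>b. c b \<in> smooth_funs M'" "openin (mtop M') W" "p \<in> W" "W \<subseteq> U"
    "\<And>b q. q \<in> W \<Longrightarrow> c b q = h q \<bullet> b"
    using M'.coordinate_functions_exist[OF U] by metis
  obtain O' where O': "open O'" "h ` W = E' \<inter> O'" using M'.chart_image_open[OF U(1) c(2,4)] by metis
  have "\<zeta> \<bullet> b = 0" for b
  proof -
    have bl: "bounded_linear (\<lambda>y::'f. y \<bullet> b)" by (rule bounded_linear_inner_left)
    have "?v (c b) = frechet_derivative (\<lambda>y. y \<bullet> b) (at (h p)) \<zeta>"
    proof (rule M'.chart_vector_eq[OF U \<zeta>(1) c(1)])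
      show "h p \<in> O'" using c(3) O'(2) by blast
      show "smooth_on_open O' (\<lambda>y. y \<bullet> b)" by (rule smooth_on_open_linear[OF bl O'(1)])
      show "c b q = h q \<bullet> b" if "q \<in> U" "h q \<in> O'" for q
        using c(5) M'.chart_imageD[OF U(1) c(4) O'(2) that] by blast
    qed
    also have "frechet_derivative (\<lambda>y. y \<bullet> b) (at (h p)) = (\<lambda>y. y \<bullet> b)"
      using frechet_derivative_at[OF bounded_linear_imp_has_derivative[OF bl]] by simp
    finally show ?thesis using v0 by simp
  qed
  then show ?thesis using inner_eq_zero_iff by blast
qed

text \<open>With \<open>L\<close> a left inverse on \<open>E'\<close> of the derivative of the
  inclusion in charts, and \<open>g\<close> the local inverse of an auxiliary square map, the
  retraction is \<open>g\<close> after \<open>L\<close>: on chart points the square map sends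
  \<open>h q\<close> to \<open>L (k q)\<close>. The set \<open>W\<close> is open in
  \<open>M'\<close>, as fits an immersion that may fail to be an embedding.\<close>

lemma local_retraction_exists:
  assumes U: "(U, h) \<in> atlas M'" "p \<in> U" and V: "(V, k) \<in> atlas M" "p \<in> V"
  obtains G R W where "smooth_on_open G R" "openin (mtop M') W" "p \<in> W" "W \<subseteq> U" "W \<subseteq> V"
    "\<And>q. q \<in> W \<Longrightarrow> k q \<in> G \<and> R (k q) = h q"
proof -
  obtain G T where T: "h p \<in> G" "smooth_on_open G T" "\<And>q. q \<in> U \<Longrightarrow> h q \<in> G \<Longrightarrow> q \<in> V \<and> T (h q) = k q"
    using inclusion_local_rep[OF U V] by metis
  have G: "open G" using T(2) by (simp add: smooth_on_open_def)
  note dT = smooth_on_open_has_derivative[OF T(2,1)]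
  let ?D = "frechet_derivative T (at (h p))"
  have linD: "linear ?D" by (rule bounded_linear.linear[OF has_derivative_bounded_linear[OF dT]])
  have "inj_on ?D E'"
    using linear_injective_on_subspace_0[OF linD M'.subspace_E]
      immersion_derivative_injective[OF U V T] by blast
  then obtain L where L: "range L \<subseteq> E'" "linear L" "\<And>v. v \<in> E' \<Longrightarrow> L (?D v) = v"
    using linear_exists_left_inverse_on[OF linD M'.subspace_E] by blast
  obtain P where P: "linear P" "\<And>x. P x \<in> E'" "\<And>x. x \<in> E' \<Longrightarrow> P x = x"
      "\<And>x y. y \<in> E' \<Longrightarrow> P x \<bullet> y = x \<bullet> y"
    using orthogonal_projection_exists[OF M'.subspace_E] by metis
  note bL = linear_conv_bounded_linear[THEN iffD1, OF L(2)] and bP = linear_conv_bounded_linear[THEN iffD1, OF P(1)]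
  \<comment> \<open>On the model space \<open>E'\<close> this is \<open>L \<circ> T\<close>; the second summand makes the derivative at \<open>h p\<close>
    injective on the whole Euclidean space.\<close>
  let ?f = "\<lambda>x. L (T x) + (x - P x)"
  have f: "smooth_on_open G ?f"
    by (intro smooth_on_open_add smooth_on_open_diff smooth_on_open_linear_compose[OF bL T(2)]
        smooth_on_open_linear[OF bP G] smooth_on_open_linear[OF bounded_linear_ident G])
  have df: "frechet_derivative ?f (at (h p)) = (\<lambda>v. L (?D v) + (v - P v))"
    by (rule frechet_derivative_at[OF has_derivative_add[OF bounded_linear.has_derivative[OF bL dT]
            has_derivative_diff[OF has_derivative_ident bounded_linear_imp_has_derivative[OF bP]]], symmetric])
  have "inj (\<lambda>v. L (?D v) + (v - P v))"
  proof -
    have lin: "linear (\<lambda>v. L (?D v) + (v - P v))"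
      using linear_compose[OF linD L(2)] by (intro linear_compose_add linear_compose_sub linear_ident P(1)) (simp add: o_def)
    have "v = 0" if v: "L (?D v) + (v - P v) = 0" for v
    proof -
      have LE: "L (?D v) \<in> E'" using L(1) by blast
      \<comment> \<open>The two summands are orthogonal, so their sum vanishes only if both
        do.\<close>
      have "(v - P v) \<bullet> L (?D v) = 0" using P(4)[OF LE, of v] by (simp add: inner_diff_left)
      moreover have "v - P v = - L (?D v)" using v by (simp add: eq_neg_iff_add_eq_0 add.commute)
      ultimately have "L (?D v) = 0" by simp
      then have "v = P v" using v by simp
      then have "v \<in> E'" using P(2) by metis
      then show "v = 0" using L(3) \<open>L (?D v) = 0\<close> by simp
    qed
    then show ?thesis unfolding linear_injective_0[OF lin] by blast
  qed
  then have inj: "inj (frechet_derivative ?f (at (h p)))" unfolding df .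
  obtain N N' g where N: "open N" "N \<subseteq> G" "h p \<in> N" "?f (h p) \<in> N'" "smooth_on_open N' g"
    "\<forall>x\<in>N. ?f x \<in> N' \<and> g (?f x) = x" "g ` N' \<subseteq> N"
    by (rule smooth_inverse_function[OF f T(1) inj]) (rule that)
  have N': "open N'" using N(5) by (simp add: smooth_on_open_def)
  have op: "open {y. L y \<in> N'}"
    using continuous_open_vimage[OF N' linear_continuous_at[OF bL]] by (simp add: vimage_def)
  show ?thesis
  proof
    show "smooth_on_open {y. L y \<in> N'} (\<lambda>y. g (L y))"
      by (rule smooth_on_open_compose[OF N(5) smooth_on_open_linear[OF bL op]]) auto
    show "openin (mtop M') {q \<in> U. h q \<in> N}" by (rule M'.chart_preimage_open[OF U(1) N(1)])
    show "p \<in> {q \<in> U. h q \<in> N}" using U(2) N(3) by simp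
    show "{q \<in> U. h q \<in> N} \<subseteq> V" using T(3) N(2) by blast
    show "k q \<in> {y. L y \<in> N'} \<and> g (L (k q)) = h q" if q: "q \<in> {q \<in> U. h q \<in> N}" for q
    proof -
      have "P (h q) = h q" using P(3) M'.chart_in_E[OF U(1)] q by blast
      moreover have "T (h q) = k q" using T(3) q N(2) by blast
      ultimately have "?f (h q) = L (k q)" by simp
      then show ?thesis using bspec[OF N(6), of "h q"] q by simp
    qed
  qed auto
qed

section \<open>Local extension of vector fields\<close>

text \<open>This makes the choices in \<open>cov_deriv_along\<close> meaningful. Agreement with
  \<open>X\<close> is obtained on a neighbourhood of \<open>p\<close> in \<open>M'\<close>, where
  the retraction is valid, the \<open>c b\<close> are true coordinates and \<open>\<beta>\<close> is
  1.\<close>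

lemma extension_exists:
  assumes X: "X \<in> vfields M'" and p: "p \<in> points M'"
  obtains Xe where "extends_near M M' p X Xe"
proof -
  obtain U h where U: "(U, h) \<in> atlas M'" "p \<in> U" using M'.chart_at[OF p] by blast
  obtain V k where V: "(V, k) \<in> atlas M" "p \<in> V" using M.chart_at[of p] p points_subset by blast
  obtain c Wc where c: "\<And>b. c b \<in> smooth_funs M" "openin (mtop M) Wc" "p \<in> Wc" "Wc \<subseteq> V"
    "\<And>b q. q \<in> Wc \<Longrightarrow> c b q = k q \<bullet> b"
    using M.coordinate_functions_exist[OF V] by metis
  obtain G R W where R: "smooth_on_open G R" "openin (mtop M') W" "p \<in> W" "W \<subseteq> U" "W \<subseteq> V"
    "\<And>q. q \<in> W \<Longrightarrow> k q \<in> G \<and> R (k q) = h q"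
    using local_retraction_exists[OF U V] by metis
  have "(\<lambda>q. X q (c b)) \<in> smooth_funs M'" for b
    using X smooth_funs_restrict[OF c(1)] by (auto simp: vfields_def)
  then have "\<exists>Gb a. h p \<in> Gb \<and> smooth_on_open Gb a \<and> (\<forall>q\<in>U. h q \<in> Gb \<longrightarrow> X q (c b) = a (h q))" for b
    using M'.smooth_funsE[OF _ U] by metis
  then obtain Gb a where a: "\<And>b. h p \<in> Gb b" "\<And>b. smooth_on_open (Gb b) (a b)"
    "\<And>b q. q \<in> U \<Longrightarrow> h q \<in> Gb b \<Longrightarrow> X q (c b) = a b (h q)"
    by metis
  \<comment> \<open>The coordinates \<open>a b\<close> of \<open>X\<close> are pulled back along the retraction \<open>R\<close>, projected to the model
    space and cut off.\<close>
  let ?G1 = "\<Inter>b\<in>Basis. Gb b"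
  have G1: "open ?G1" using a(2) by (intro open_INT) (auto simp: smooth_on_open_def)
  define H where "H = {y \<in> G. R y \<in> ?G1}"
  have H: "open H" unfolding H_def by (rule smooth_on_open_preimage[OF R(1) G1])
  have pH: "k p \<in> H" using R(3,6) a(1) by (auto simp: H_def)
  obtain P where P: "linear P" "\<And>x. P x \<in> E" "\<And>x. x \<in> E \<Longrightarrow> P x = x"
    using orthogonal_projection_exists[OF M.subspace_E] by metis
  define A where "A y = P (\<Sum>b\<in>Basis. a b (R y) *\<^sub>R b)" for y
  have A: "smooth_on_open H A"
    unfolding A_def
  proof (intro smooth_on_open_linear_compose[OF linear_conv_bounded_linear[THEN iffD1, OF P(1)]]
      smooth_on_open_sum H smooth_on_open_linear_compose[OF bounded_linear_scaleR_left])
    fix b :: 'e assume "b \<in> Basis"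
    then show "smooth_on_open H (\<lambda>x. a b (R x))"
      by (intro smooth_on_open_compose[OF a(2) smooth_on_open_subset[OF R(1) H]]) (auto simp: H_def)
  qed
  obtain \<beta> K W' where b: "\<beta> \<in> smooth_funs M" "closedin (mtop M) K" "K \<subseteq> {q \<in> V. k q \<in> H}" "K \<subseteq> V"
    "\<And>q. q \<notin> K \<Longrightarrow> \<beta> q = 0" "openin (mtop M) W'" "p \<in> W'" "W' \<subseteq> K" "\<And>q. q \<in> W' \<Longrightarrow> \<beta> q = (1::real)"
    by (rule M.cutoff_exists[OF V M.chart_preimage_open[OF V(1) H]]) (use V pH in auto)
  define Xe where "Xe q = (if q \<in> K then M.chart_vector V k q (\<beta> q *\<^sub>R A (k q)) else (\<lambda>f. 0))" for q
  have AE: "t *\<^sub>R A y \<in> E" for t y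
    using P(2) M.subspace_E by (auto simp: A_def intro: subspace_scale)
  \<comment> \<open>An explicit formula on all of \<open>V\<close>, with both sides zero off
    \<open>K\<close>. It exhibits \<open>Xe\<close> applied to \<open>f\<close> as a smooth
    expression in the coordinates.\<close>
  have Xe_f: "Xe q f = \<beta> q * (\<Sum>b\<in>Basis. (A (k q) \<bullet> b) * frechet_derivative F (at (k q)) b)"
    if f: "f \<in> smooth_funs M" and F: "k q \<in> G'" "smooth_on_open G' F" "\<And>x. x \<in> V \<Longrightarrow> k x \<in> G' \<Longrightarrow> f x = F (k x)"
      and q: "q \<in> V" for f q G' F
  proof (cases "q \<in> K")
    case True
    have lin: "linear (frechet_derivative F (at (k q)))"
      by (rule bounded_linear.linear[OF has_derivative_bounded_linear[OF smooth_on_open_has_derivative[OF F(2,1)]]])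
    have "Xe q f = \<beta> q * frechet_derivative F (at (k q)) (A (k q))"
      using M.chart_vector_eq[OF V(1) q AE f F] True by (simp add: Xe_def linear_scale[OF lin])
    also have "frechet_derivative F (at (k q)) (A (k q)) =
        frechet_derivative F (at (k q)) (\<Sum>b\<in>Basis. (A (k q) \<bullet> b) *\<^sub>R b)"
      by (simp only: euclidean_representation)
    also have "\<dots> = (\<Sum>b\<in>Basis. (A (k q) \<bullet> b) * frechet_derivative F (at (k q)) b)"
      by (simp only: linear_sum[OF lin] linear_scale[OF lin] real_scaleR_def)
    finally show ?thesis .
  qed (simp add: Xe_def b(5))
  have "Xe \<in> vfields M"
    unfolding vfields_def
  proof (intro CollectI conjI ballI allI impI)
    show "Xe q \<in> tangent_space M q" for q
      using M.chart_vector_tangent[OF V(1) _ AE] M.zero_tangent b(4) by (auto simp: Xe_def)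
    show "Xe q = (\<lambda>f. 0)" if "q \<notin> points M" for q
      using that b(4) M.chart_subset[OF V(1)] by (auto simp: Xe_def)
    fix f assume f: "f \<in> smooth_funs M"
    show "(\<lambda>q. Xe q f) \<in> smooth_funs M"
    proof (rule M.smooth_funs_glue[OF b(2)])
      fix q assume q: "q \<in> K"
      then have qV: "q \<in> V" "k q \<in> H" using b(3) by auto
      obtain G' F where F: "k q \<in> G'" "smooth_on_open G' F" "\<And>x. x \<in> V \<Longrightarrow> k x \<in> G' \<Longrightarrow> f x = F (k x)"
        using M.smooth_funsE[OF f V(1) qV(1)] by metis
      obtain G2 B where B: "k q \<in> G2" "smooth_on_open G2 B" "\<And>x. x \<in> V \<Longrightarrow> k x \<in> G2 \<Longrightarrow> \<beta> x = B (k x)"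
        using M.smooth_funsE[OF b(1) V(1) qV(1)] by metis
      let ?S = "H \<inter> G' \<inter> G2"
      have S: "open ?S" using H F(2) B(2) by (auto simp: smooth_on_open_def)
      have sub: "smooth_on_open ?S A" "smooth_on_open ?S F" "smooth_on_open ?S B"
        using smooth_on_open_subset[OF A S] smooth_on_open_subset[OF F(2) S] smooth_on_open_subset[OF B(2) S] by auto
      show "M.smooth_at (\<lambda>q. Xe q f) q"
      proof (rule M.smooth_atI[OF V(1) qV(1)])
        show "k q \<in> ?S" using qV F(1) B(1) by blast
        show "smooth_on_open ?S (\<lambda>y. B y * (\<Sum>b\<in>Basis. (A y \<bullet> b) * frechet_derivative F (at y) b))"
          by (intro smooth_on_open_bilinear[OF bounded_bilinear_mult] smooth_on_open_sum S sub
              smooth_on_open_linear_compose[OF bounded_linear_inner_left] smooth_on_open_directional)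
        show "Xe x f = B (k x) * (\<Sum>b\<in>Basis. (A (k x) \<bullet> b) * frechet_derivative F (at (k x)) b)"
          if "x \<in> V" "k x \<in> ?S" for x
          using Xe_f[OF f _ F(2,3) that(1)] B(3)[of x] that by simp
      qed
    qed (simp add: Xe_def)
  qed
  moreover have "\<exists>N. openin (mtop M') N \<and> p \<in> N \<and> (\<forall>q\<in>N. Xe q = incl M (X q))"
  proof (intro exI conjI ballI)
    let ?N = "W \<inter> ((Wc \<inter> W') \<inter> points M') \<inter> {q \<in> U. h q \<in> ?G1}"
    show "openin (mtop M') ?N"
      by (intro openin_Int R(2) openin_restrict c(2) b(6) M'.chart_preimage_open[OF U(1) G1])
    show "p \<in> ?N" using R(3) c(3) b(7) p U(2) a(1) by blast
    fix q assume q: "q \<in> ?N"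
    have "X q \<in> tangent_space M' q" using X q by (auto simp: vfields_def)
    then have v: "incl M (X q) \<in> tangent_space M q" by (rule incl_tangent)
    have qV: "q \<in> V" "q \<in> Wc" using q R(5) by auto
    have "(\<Sum>b\<in>Basis. a b (R (k q)) *\<^sub>R b) = (\<Sum>b\<in>Basis. incl M (X q) (c b) *\<^sub>R b)"
    proof (rule sum.cong)
      fix b :: 'e assume "b \<in> Basis"
      then have "X q (c b) = a b (R (k q))" using a(3)[of q b] R(6)[of q] q by auto
      then show "a b (R (k q)) *\<^sub>R b = incl M (X q) (c b) *\<^sub>R b" using c(1) by (simp add: incl_eq)
    qed simp
    \<comment> \<open>The projection in \<open>A\<close> changes nothing on the submanifold, since
      the coordinate vector of an actual tangent vector already lies in \<open>E\<close>.\<close>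
    moreover have "(\<Sum>b\<in>Basis. incl M (X q) (c b) *\<^sub>R b) \<in> E"
      by (rule M.tangent_coordinates_in_E[OF V(1) qV(1) v c(1,2) qV(2) c(4,5)])
    ultimately have "A (k q) = (\<Sum>b\<in>Basis. incl M (X q) (c b) *\<^sub>R b)" by (simp add: A_def P(3))
    moreover have "q \<in> K" "\<beta> q = 1" using q b(8,9) by auto
    ultimately show "Xe q = incl M (X q)"
      using M.tangent_eq_chart_vector[OF V(1) qV(1) v c(1,2) qV(2) c(4,5)] by (simp add: Xe_def)
  qed
  ultimately show ?thesis using that by (auto simp: extends_near_def)
qed

section \<open>Tangential projection\<close>

text \<open>The tangential part is characterised by its pairings with vectors tangent to
  \<open>M'\<close>: equal pairings make \<open>w - incl M u\<close> normal, and non-degeneracy of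
  the induced metric excludes a second candidate. Linear combinations can thus be projected by
  computing pairings.\<close>

lemma tangential_unique:
  assumes g': "pseudo_riemannian_metric M' (induced_metric M g)" and g: "pseudo_riemannian_metric M g"
    and p: "p \<in> points M'" and u: "u \<in> tangent_space M' p" and w: "w \<in> tangent_space M p"
    and orth: "\<And>v. v \<in> tangent_space M' p \<Longrightarrow> g p w (incl M v) = g p (incl M u) (incl M v)"
  shows "tangential M M' g p w = u"
  unfolding tangential_def
proof (rule the_equality)
  have pM: "p \<in> points M" using p points_subset by blast
  have lin: "g p (\<lambda>f. a * x f + b * y f) z = a * g p x z + b * g p y z"
    if "x \<in> tangent_space M p" "y \<in> tangent_space M p" "z \<in> tangent_space M p" for x y z a b
    using g pM that unfolding pseudo_riemannian_metric_def by blast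
  let ?n = "\<lambda>f. 1 * w f + (- 1) * incl M u f"
  have "?n \<in> normal_space M M' g p"
    unfolding normal_space_def
  proof (intro CollectI conjI ballI)
    show "?n \<in> tangent_space M p" by (rule M.tangent_space_lincomb[OF w incl_tangent[OF u]])
    show "g p ?n (incl M v) = 0" if "v \<in> tangent_space M' p" for v
      using lin[OF w incl_tangent[OF u] incl_tangent[OF that], of 1 "-1"] orth[OF that] by simp
  qed
  then show "u \<in> tangent_space M' p \<and> (\<exists>n\<in>normal_space M M' g p. w = (\<lambda>f. incl M u f + n f))"
    using u by (intro conjI bexI[of _ ?n]) auto
  fix u' assume "u' \<in> tangent_space M' p \<and> (\<exists>n\<in>normal_space M M' g p. w = (\<lambda>f. incl M u' f + n f))"
  then obtain n where u': "u' \<in> tangent_space M' p" and n: "n \<in> tangent_space M p"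
    "\<And>v. v \<in> tangent_space M' p \<Longrightarrow> g p n (incl M v) = 0" and w': "w = (\<lambda>f. 1 * incl M u' f + 1 * n f)"
    unfolding normal_space_def by auto
  let ?d = "\<lambda>f. 1 * u' f + (- 1) * u f"
  have d: "?d \<in> tangent_space M' p" by (rule M'.tangent_space_lincomb[OF u' u])
  have "induced_metric M g p ?d v = 0" if v: "v \<in> tangent_space M' p" for v
  proof -
    have "g p (incl M u') (incl M v) = g p (incl M u) (incl M v)"
      using lin[OF incl_tangent[OF u'] n(1) incl_tangent[OF v], of 1 1] n(2)[OF v] orth[OF v]
      unfolding w'[symmetric] by simp
    then show ?thesis
      unfolding induced_metric_def incl_lincomb
      using lin[OF incl_tangent[OF u'] incl_tangent[OF u] incl_tangent[OF v], of 1 "-1"] by simp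
  qed
  then have "?d = (\<lambda>f. 0)" using g' p d unfolding pseudo_riemannian_metric_def by blast
  then show "u' = u" by (auto simp: fun_eq_iff)
qed

text \<open>Pairing with \<open>w\<close> is a linear functional on the tangent space of
  \<open>M'\<close>; the vector representing it in the induced metric is the tangential
  part.\<close>

lemma tangential_exists:
  assumes g': "pseudo_riemannian_metric M' (induced_metric M g)" and g: "pseudo_riemannian_metric M g"
    and p: "p \<in> points M'" and w: "w \<in> tangent_space M p"
  shows "tangential M M' g p w \<in> tangent_space M' p"
    and "\<And>v. v \<in> tangent_space M' p \<Longrightarrow> g p (incl M (tangential M M' g p w)) (incl M v) = g p w (incl M v)"
proof -
  have pM: "p \<in> points M" using p points_subset by blast
  have lin: "g p w (incl M (\<lambda>f. a * u f + b * v f)) = a * g p w (incl M u) + b * g p w (incl M v)"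
    if "u \<in> tangent_space M' p" "v \<in> tangent_space M' p" for u v a b
  proof -
    note uv = incl_tangent[OF that(1)] incl_tangent[OF that(2)]
    have sym: "g p w z = g p z w" if "z \<in> tangent_space M p" for z
      using g pM w that unfolding pseudo_riemannian_metric_def by blast
    show ?thesis
      unfolding incl_lincomb sym[OF M.tangent_space_lincomb[OF uv]] sym[OF uv(1)] sym[OF uv(2)]
      using g pM w uv unfolding pseudo_riemannian_metric_def by blast
  qed
  obtain u where u: "u \<in> tangent_space M' p"
    "\<forall>v\<in>tangent_space M' p. induced_metric M g p u v = g p w (incl M v)"
    by (rule M'.tangent_functional_represented[OF p g' lin])
  have "tangential M M' g p w = u"
    by (rule tangential_unique[OF g' g p u(1) w]) (use u(2) in \<open>simp add: induced_metric_def\<close>)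
  then show "tangential M M' g p w \<in> tangent_space M' p"
    and "\<And>v. v \<in> tangent_space M' p \<Longrightarrow> g p (incl M (tangential M M' g p w)) (incl M v) = g p w (incl M v)"
    using u by (auto simp: induced_metric_def)
qed

end

section \<open>Comparison of the induced structures\<close>

lemma smooth_submanifold_imp_immersed:
  assumes "smooth_manifold n M" "smooth_submanifold m M' M"
  obtains E E' where "immersed_submanifold M E M' E'"
proof -
  obtain E where E: "smooth_mfd M E" using assms(1) smooth_manifold_imp_smooth_mfd by blast
  obtain E' where E': "smooth_mfd M' E'"
    using assms(2) smooth_manifold_imp_smooth_mfd unfolding smooth_submanifold_def by blast
  show ?thesis
  proof (rule that[OF immersed_submanifold.intro[OF E E']])
    show "immersed_submanifold_axioms M M'"
      using assms(2) unfolding smooth_submanifold_def immersed_submanifold_axioms_def by blast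
  qed
qed

theorem proposition4p5:
  fixes n m :: nat
    and M :: "('a, 'e::euclidean_space) manifold"
    and M' :: "('a, 'f::euclidean_space) manifold"
    and g g2 :: "'a metric" and \<eta> :: "'a form1" and D D2 :: "'a connection"
  assumes "smooth_manifold n M"
    and "pseudo_riemannian_metric M g"
    and "pseudo_riemannian_submanifold m M' M g"
    and "SWMT M (g, \<eta>, D)"
    and "SWMT M (g2, \<eta>, D2)"
    and "conf_proj_equiv M (g, \<eta>, D) (g2, \<eta>, D2)"
  shows "conf_proj_equiv M' (induced_triple M M' (g, \<eta>, D)) (induced_triple M M' (g2, \<eta>, D2))"
proof -
  obtain E E' where "immersed_submanifold M E M' E'"
    using smooth_submanifold_imp_immersed assms(1,3) unfolding pseudo_riemannian_submanifold_def by blast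
  then interpret immersed_submanifold M E M' E' .
  note g = assms(2)
  have g': "pseudo_riemannian_metric M' (induced_metric M g)"
    using assms(3) by (simp add: pseudo_riemannian_submanifold_def)
  obtain \<phi> \<psi> where \<phi>: "\<phi> \<in> smooth_funs M" and \<psi>: "\<psi> \<in> smooth_funs M"
    and conf: "\<And>p u v. p \<in> points M \<Longrightarrow> u \<in> tangent_space M p \<Longrightarrow> v \<in> tangent_space M p \<Longrightarrow>
           g2 p u v = exp (\<phi> p + \<psi> p) * g p u v"
    and D2: "\<And>X Y p. X \<in> vfields M \<Longrightarrow> Y \<in> vfields M \<Longrightarrow> p \<in> points M \<Longrightarrow>
           D2 X Y p = (\<lambda>f. D X Y p f + X p \<phi> * Y p f + Y p \<phi> * X p f
                           - g p (X p) (Y p) * grad M g \<psi> p f)"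
    using assms(6) by auto
  have D: "D X Y \<in> vfields M" if "X \<in> vfields M" "Y \<in> vfields M" for X Y
    using assms(4) that by (simp add: affine_connection_def)
  have conn: "induced_connection M M' g2 D2 X Y p = (\<lambda>f. induced_connection M M' g D X Y p f
      + X p \<phi> * Y p f + Y p \<phi> * X p f
      - induced_metric M g p (X p) (Y p) * grad M' (induced_metric M g) \<psi> p f)"
    if X: "X \<in> vfields M'" and Y: "Y \<in> vfields M'" and p: "p \<in> points M'" for X Y p
  proof -
    have pM: "p \<in> points M" using p points_subset by blast
    \<comment> \<open>The same two terms occur in \<open>cov_deriv_along\<close> for
      \<open>D\<close> and for \<open>D2\<close>.\<close>
    define Xe where "Xe = (SOME Xe. extends_near M M' p X Xe)"
    define Ye where "Ye = (SOME Ye. extends_near M M' p Y Ye)"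
    have "extends_near M M' p X Xe"
      unfolding Xe_def using extension_exists[OF X p] by (metis someI_ex)
    then have Xe: "Xe \<in> vfields M" "Xe p = incl M (X p)" by (auto simp: extends_near_def)
    have "extends_near M M' p Y Ye"
      unfolding Ye_def using extension_exists[OF Y p] by (metis someI_ex)
    then have Ye: "Ye \<in> vfields M" "Ye p = incl M (Y p)" by (auto simp: extends_near_def)
    have Xp: "X p \<in> tangent_space M' p" and Yp: "Y p \<in> tangent_space M' p"
      using X Y p by (auto simp: vfields_def)
    let ?w = "D Xe Ye p" and ?G = "grad M g \<psi> p" and ?G' = "grad M' (induced_metric M g) \<psi> p"
    let ?s = "induced_metric M g p (X p) (Y p)"
    let ?t = "tangential M M' g p ?w"
    have w: "?w \<in> tangent_space M p" using D[OF Xe(1) Ye(1)] pM by (simp add: vfields_def)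
    note G = M.grad_represents[OF pM g \<psi>] and G' = M'.grad_represents[OF p g' smooth_funs_restrict[OF \<psi>]]
    note t = tangential_exists[OF g' g p w]
    \<comment> \<open>The coefficients 1 and the bracketing follow the pattern of
      \<open>tangent_space_lincomb\<close> and of the linearity of the metric, which are then
      applied literally. \<open>X p \<phi>\<close> replaces the derivative along
      \<open>Xe p\<close>, since \<open>\<phi>\<close> is smooth on \<open>M\<close>.\<close>
    have D2w: "D2 Xe Ye p = (\<lambda>f. 1 * (1 * ?w f + X p \<phi> * incl M (Y p) f)
        + 1 * (Y p \<phi> * incl M (X p) f + (- ?s) * ?G f))"
      using D2[OF Xe(1) Ye(1) pM] \<phi> by (auto simp: Xe(2) Ye(2) incl_eq induced_metric_def)
    define u where "u = (\<lambda>f. 1 * (1 * ?t f + X p \<phi> * Y p f) + 1 * (Y p \<phi> * X p f + (- ?s) * ?G' f))"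
    note T1 = M.tangent_space_lincomb[OF w incl_tangent[OF Yp], of 1 "X p \<phi>"]
      M.tangent_space_lincomb[OF incl_tangent[OF Xp] G(1), of "Y p \<phi>" "- ?s"]
    note T2 = M'.tangent_space_lincomb[OF t(1) Yp, of 1 "X p \<phi>"]
      M'.tangent_space_lincomb[OF Xp G'(1), of "Y p \<phi>" "- ?s"]
    have D2wT: "D2 Xe Ye p \<in> tangent_space M p"
      unfolding D2w by (rule M.tangent_space_lincomb[OF T1])
    have uT: "u \<in> tangent_space M' p"
      unfolding u_def by (rule M'.tangent_space_lincomb[OF T2])
    have lin: "g p (\<lambda>f. a * x f + b * y f) z = a * g p x z + b * g p y z"
      if "x \<in> tangent_space M p" "y \<in> tangent_space M p" "z \<in> tangent_space M p" for x y z a b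
      using g pM that unfolding pseudo_riemannian_metric_def by blast
    have "g p (D2 Xe Ye p) (incl M v) = g p (incl M u) (incl M v)" if v: "v \<in> tangent_space M' p" for v
    proof -
      note v' = incl_tangent[OF v]
      \<comment> \<open>Both gradients pair with \<open>v\<close> to \<open>v \<psi>\<close>,
        because \<open>incl M v\<close> and \<open>v\<close> agree on the ambient smooth function
        \<open>\<psi>\<close>.\<close>
      have "g p ?G (incl M v) = v \<psi>" using G(2)[OF v'] \<psi> by (simp add: incl_eq)
      then have GG: "g p ?G (incl M v) = g p (incl M ?G') (incl M v)"
        using G'(2)[OF v] by (simp add: induced_metric_def)
      note i = incl_tangent[OF t(1)] incl_tangent[OF Xp] incl_tangent[OF Yp] incl_tangent[OF G'(1)]
      note I = M.tangent_space_lincomb[OF i(1,3), of 1 "X p \<phi>"]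
        M.tangent_space_lincomb[OF i(2,4), of "Y p \<phi>" "- ?s"]
      have "g p (D2 Xe Ye p) (incl M v) = (g p ?w (incl M v) + X p \<phi> * g p (incl M (Y p)) (incl M v))
          + (Y p \<phi> * g p (incl M (X p)) (incl M v) + (- ?s) * g p ?G (incl M v))"
        unfolding D2w lin[OF T1 v'] lin[OF w i(3) v'] lin[OF i(2) G(1) v'] by simp
      also have "\<dots> = g p (incl M u) (incl M v)"
        unfolding u_def incl_lincomb lin[OF I v'] lin[OF i(1,3) v'] lin[OF i(2,4) v'] t(2)[OF v] GG by simp
      finally show ?thesis .
    qed
    then have tg: "tangential M M' g p (D2 Xe Ye p) = u"
      by (rule tangential_unique[OF g' g p uT D2wT])
    \<comment> \<open>The conformal factor is an exponential, hence never zero, so orthogonality to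
      the submanifold is the same for both metrics.\<close>
    have "normal_space M M' g2 p = normal_space M M' g p"
      unfolding normal_space_def using conf[OF pM _ incl_tangent] by auto
    then have "tangential M M' g2 p = tangential M M' g p" by (simp add: tangential_def fun_eq_iff)
    then have "induced_connection M M' g2 D2 X Y p = u"
      using p tg by (simp add: induced_connection_def cov_deriv_along_def Xe_def Ye_def)
    moreover have "induced_connection M M' g D X Y p = ?t"
      using p by (simp add: induced_connection_def cov_deriv_along_def Xe_def Ye_def)
    ultimately show ?thesis by (simp add: u_def fun_eq_iff)
  qed
  have met: "induced_metric M g2 p u v = exp (\<phi> p + \<psi> p) * induced_metric M g p u v"
    if "p \<in> points M'" "u \<in> tangent_space M' p" "v \<in> tangent_space M' p" for p u v
    using conf[OF _ incl_tangent[OF that(2)] incl_tangent[OF that(3)]] that(1) points_subset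
    by (auto simp: induced_metric_def)
  show ?thesis
    using smooth_funs_restrict[OF \<phi>] smooth_funs_restrict[OF \<psi>] conn met by auto
qed

end
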